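(* Let $M_0,M_1,M_2,M_3\ge 0$ and let $(S_n)_{n\ge0}$ be the monic orthogonal polynomials ($\deg S_n=n$) with respect to the inner product $$(P,Q)=\int_{\mathbb{R}}P(x)Q(x)e^{-x^2}\,dx+\sum_{i=0}^{3}M_i\,P^{(i)}(0)\,Q^{(i)}(0).$$ Then the following limits hold, all of them uniformly on compact subsets of the complex plane. (a) Even degree: $$\lim_{n\to\infty}\frac{(-1)^n\sqrt n}{n!}\,S_{2n}\!\left(\frac{x}{2\sqrt n}\right)=\begin{cases}\left(\frac x2\right)^{1/2}J_{-1/2}(x)&\text{if }M_0=0,\ M_2=0,\\[2pt] -\left(\frac x2\right)^{1/2}J_{3/2}(x)&\text{if }M_0>0,\ M_2=0,\\[2pt] \left(\frac x2\right)^{1/2}\left[\frac23J_{7/2}(x)-J_{3/2}(x)-\frac23J_{-1/2}(x)\right]&\text{if }M_0=0,\ M_2>0,\\[2pt] \left(\frac x2\right)^{1/2}J_{7/2}(x)&\text{if }M_0>0,\ M_2>0.\end{cases}$$ (b) Odd degree: $$\lim_{n\to\infty}\frac{(-1)^n}{n!}\,S_{2n+1}\!\left(\frac{x}{2\sqrt n}\right)=\begin{cases}\left(\frac x2\right)^{1/2}J_{1/2}(x)&\text{if }M_1=0,\ M_3=0,\\[2pt] -\left(\frac x2\right)^{1/2}J_{5/2}(x)&\text{if }M_1>0,\ M_3=0,\\[2pt] \left(\frac x2\right)^{1/2}\left[\frac25J_{9/2}(x)-J_{5/2}(x)-\frac25J_{1/2}(x)\right]&\text{if }M_1=0,\ M_3>0,\\[2pt]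 \left(\frac x2\right)^{1/2}J_{9/2}(x)&\text{if }M_1>0,\ M_3>0.\end{cases}$$
   Context: For $\alpha\in\mathbb{R}$, $J_\alpha$ is the Bessel function of the first kind, $J_\alpha(z)=\sum_{m=0}^\infty\frac{(-1)^m}{m!\,\Gamma(m+\alpha+1)}\left(\frac z2\right)^{2m+\alpha}$. The function $\left(\frac x2\right)^{1/2}J_\alpha(x)$, for $\alpha\in\{-\frac12,\frac12,\frac32,\frac52,\frac72,\frac92\}$, denotes the entire function $\sum_{m=0}^\infty\frac{(-1)^m}{m!\,\Gamma(m+\alpha+1)}\left(\frac x2\right)^{2m+\alpha+1/2}$. Polynomials have real coefficients; the sequence of monic orthogonal polynomials is the unique one with $S_n$ monic of degree $n$ and orthogonal to all polynomials of degree less than $n$. *)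

theory Defs
  imports "HOL-Analysis.Analysis" "HOL-Computational_Algebra.Polynomial"
begin

definition bessel_J :: "real \<Rightarrow> complex \<Rightarrow> complex" where
  "bessel_J \<alpha> z =
     (\<Sum>m. (-1) ^ m / (fact m * of_real (Gamma (real m + \<alpha> + 1)))
            * (z / 2) powr of_real (2 * real m + \<alpha>))"

text \<open>
  The entire function \<open>(x/2)\<^sup>1\<^sup>/\<^sup>2 J\<^sub>\<alpha>(x)\<close>, for \<open>\<alpha> \<in> {-1/2, 1/2, 3/2, \<dots>}\<close>. Then \<open>\<alpha> + 1/2\<close> is
  a natural number, so the exponent \<open>2m + \<alpha> + 1/2\<close> is written as a natural-number power. This
  gives the right value at \<open>x = 0\<close> too, whereas \<open>0 powr 0 = 0\<close>. For other \<open>\<alpha>\<close> the definition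
  is not meaningful.
\<close>
definition sqrt_bessel_J :: "real \<Rightarrow> complex \<Rightarrow> complex" where
  "sqrt_bessel_J \<alpha> x =
     (\<Sum>m. (-1) ^ m / (fact m * of_real (Gamma (real m + \<alpha> + 1)))
            * (x / 2) ^ (2 * m + nat \<lfloor>\<alpha> + 1 / 2\<rfloor>))"

lemma summable_sqrt_bessel_J:
  fixes x :: complex
  assumes "\<alpha> \<ge> - 1 / 2"
  shows "summable (\<lambda>m. (-1) ^ m / (fact m * complex_of_real (Gamma (real m + \<alpha> + 1)))
                         * (x / 2) ^ (2 * m + k))" (is "summable ?f")
proof (rule summable_ratio_test)
  show "(1 / 2 :: real) < 1" by simp
  define r where "r = norm (x / 2) ^ 2"
  have r: "r \<ge> 0" unfolding r_def by simp
  fix m assume m: "m \<ge> nat \<lceil>2 * r\<rceil> + 1"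
  then have m': "real m \<ge> 2 * r" "real m \<ge> 1" by linarith+
  have pos: "real m + \<alpha> + 1 > 0" using assms m' by linarith
  have G: "Gamma (real m + \<alpha> + 1) > 0" using pos by (rule Gamma_real_pos)
  have ni: "real m + \<alpha> + 1 \<notin> \<int>\<^sub>\<le>\<^sub>0"
    using pos by (metis nonpos_Ints_nonpos not_le)
  have Gs: "Gamma (real (Suc m) + \<alpha> + 1) = (real m + \<alpha> + 1) * Gamma (real m + \<alpha> + 1)"
    using Gamma_plus1[OF ni] by (simp add: add_ac)
  have f: "norm (?f j) = norm (x / 2) ^ (2 * j + k) / (fact j * Gamma (real j + \<alpha> + 1))"
    if "Gamma (real j + \<alpha> + 1) > 0" for j
    using that by (simp add: norm_mult norm_divide norm_power)
  have Gs_pos: "Gamma (real (Suc m) + \<alpha> + 1) > 0"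
    unfolding Gs using pos G by simp
  have "norm (?f (Suc m)) = r / ((real m + 1) * (real m + \<alpha> + 1)) * norm (?f m)"
    unfolding f[OF Gs_pos] f[OF G] unfolding Gs r_def
    using G pos by (simp add: power_add power2_eq_square mult_ac add_ac)
  also have "r / ((real m + 1) * (real m + \<alpha> + 1)) \<le> 1 / 2"
  proof -
    have "2 * r * 1 \<le> (real m + 1) * (real m + \<alpha> + 1)"
      using m' assms r by (intro mult_mono) auto
    then show ?thesis using pos by (simp add: divide_le_eq)
  qed
  finally show "norm (?f (Suc m)) \<le> 1 / 2 * norm (?f m)"
    by (simp add: mult_right_mono)
qed

lemma sqrt_bessel_J_eq:
  assumes "\<alpha> = real k - 1 / 2" and "x \<noteq> 0"
  shows "sqrt_bessel_J \<alpha> x = (x / 2) powr (1 / 2) * bessel_J \<alpha> x"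
proof -
  define c where "c = (\<lambda>m. (-1) ^ m / (fact m * complex_of_real (Gamma (real m + \<alpha> + 1))))"
  define p where "p = (x / 2) powr (1 / 2)"
  define g where "g = (\<lambda>m. c m * (x / 2) powr of_real (2 * real m + \<alpha>))"
  have k: "nat \<lfloor>\<alpha> + 1 / 2\<rfloor> = k"
    using assms(1) by simp
  have p: "p \<noteq> 0"
    using assms(2) by (simp add: p_def)
  have eq: "c m * (x / 2) ^ (2 * m + k) = p * g m" for m
  proof -
    have e: "1 / 2 + complex_of_real (2 * real m + \<alpha>) = of_nat (2 * m + k)"
      using assms(1) by simp
    have "p * (x / 2) powr of_real (2 * real m + \<alpha>) = (x / 2) powr (of_nat (2 * m + k))"
      unfolding p_def by (simp only: powr_add [symmetric] e)
    also have "\<dots> = (x / 2) ^ (2 * m + k)"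
      using assms(2) by (intro powr_nat') auto
    finally show ?thesis
      by (simp add: g_def mult.left_commute)
  qed
  have "summable (\<lambda>m. c m * (x / 2) ^ (2 * m + k))"
    unfolding c_def using assms(1) by (intro summable_sqrt_bessel_J) simp
  then have "summable g"
    using p by (simp add: eq)
  then have "(\<Sum>m. p * g m) = p * suminf g"
    by (rule suminf_mult)
  then show ?thesis
    by (simp only: sqrt_bessel_J_def bessel_J_def k eq [unfolded c_def] p_def g_def c_def)
qed

definition sobolev_inner :: "(nat \<Rightarrow> real) \<Rightarrow> real poly \<Rightarrow> real poly \<Rightarrow> real" where
  "sobolev_inner M P Q =
     (LINT x|lborel. poly P x * poly Q x * exp (- (x ^ 2)))
     + (\<Sum>i\<le>3. M i * poly ((pderiv ^^ i) P) 0 * poly ((pderiv ^^ i) Q) 0)"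

definition monic_orthogonal_seq ::
    "(real poly \<Rightarrow> real poly \<Rightarrow> real) \<Rightarrow> (nat \<Rightarrow> real poly) \<Rightarrow> bool" where
  "monic_orthogonal_seq ip S \<longleftrightarrow>
     (\<forall>n. degree (S n) = n \<and> lead_coeff (S n) = 1 \<and>
          (\<forall>Q. degree Q < n \<longrightarrow> ip (S n) Q = 0))"

abbreviation cpoly :: "real poly \<Rightarrow> complex \<Rightarrow> complex" where
  "cpoly P z \<equiv> poly (map_poly of_real P) z"

end

theory Submission
  imports Defs "HOL-Probability.Distributions"
begin

text \<open>
  The inner product differs from the Gaussian one only through the coefficients of \<open>x\<^sup>0, \<dots>, x\<^sup>3\<close>, and
  parity separates even from odd degrees. Fix the parity \<open>e \<in> {0, 1}\<close> and a degree \<open>2n + e\<close>. Only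
  the masses \<open>M\<^sub>e\<close> and \<open>M\<^sub>e\<^sub>+\<^sub>2\<close> are then visible.

  For \<open>r = e + 2i\<close> with \<open>i = 0, 1, 2\<close>, let \<open>L\<close> be the monic Laguerre polynomial of degree \<open>n - i\<close> and
  parameter \<open>r - 1/2\<close>. Then \<open>G\<^sub>i(x) = x\<^sup>r L(x\<^sup>2)\<close> is monic of degree \<open>2n + e\<close>.
  Each \<open>G\<^sub>i\<close> is Gauss-orthogonal to \<open>x\<^sup>q\<close> for \<open>e + 2i \<le> q < 2n + e\<close>, because
  \<open>x\<^sup>r x\<^sup>r exp (-x\<^sup>2)\<close> turns into the Laguerre weight of parameter \<open>r - 1/2\<close> under \<open>t = x\<^sup>2\<close>, while \<open>x\<^sup>q\<close>
  of the other parity pairs to zero by symmetry. So any combination \<open>A G\<^sub>0 + B G\<^sub>1 + C G\<^sub>2\<close>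
  satisfies all orthogonality conditions except those against
  \<open>x\<^sup>e\<close> and \<open>x\<^sup>e\<^sup>+\<^sup>2\<close>. These two, together with \<open>A + B + C = 1\<close>, form a \<open>3 \<times> 3\<close> linear system. Its
  entries follow from the Chu-Vandermonde sum \<open>Gamma_vandermonde\<close>; it has an explicit solution with
  a positive common denominator (\<open>mix_denom_pos\<close>, \<open>mix_solves\<close>). Since the inner product is positive
  definite, the combination is \<open>S\<^sub>2\<^sub>n\<^sub>+\<^sub>e\<close> (\<open>sobolev_hermite_eq\<close>).

  The masses enter the system multiplied by factors that tend to infinity with \<open>n\<close>. This is why
  the limits of \<open>A\<close>, \<open>B\<close>, \<open>C\<close> depend only on which masses vanish (\<open>mix_limits\<close>): they are
  \<open>(1, 0, 0)\<close>, \<open>(0, 1, 0)\<close>, \<open>(-1/\<kappa>, 1, 1/\<kappa>)\<close> or \<open>(0, 0, 1)\<close> with \<open>\<kappa> = e + 3/2\<close>. Finally, a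
  Mehler-Heine formula (\<open>mehler_heine\<close>) gives the locally uniform limit of each rescaled \<open>G\<^sub>i\<close> as
  \<open>(-1)\<^sup>i (x/2)\<^sup>1\<^sup>/\<^sup>2 J\<^sub>\<alpha>(x)\<close> with \<open>\<alpha> = e + 2i - 1/2\<close>. Adding up the three limits gives the four cases.
\<close>

section \<open>Gaussian moments and the inner product\<close>

definition gauss_moment :: "nat \<Rightarrow> real" where
  "gauss_moment k = (if even k then Gamma ((real k + 1) / 2) else 0)"

lemma has_bochner_integral_gauss_moment:
  "has_bochner_integral lborel (\<lambda>x. x ^ k * exp (- (x ^ 2))) (gauss_moment k)"
proof (cases "even k")
  case True
  then obtain m where k: "k = 2 * m" by blast
  have "Gamma (real m + 1 / 2) = pochhammer (1 / 2) m * Gamma (1 / 2 :: real)"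
    by (subst pochhammer_Gamma) (auto simp: add_ac Gamma_eq_zero_iff dest: nonpos_Ints_nonpos)
  also have "\<dots> = sqrt pi * (fact (2 * m) / (2 ^ (2 * m) * fact m))"
    by (simp add: fact_double Gamma_one_half_real)
  finally have G: "gauss_moment k = 2 * (sqrt pi / 2 * (fact (2 * m) / (2 ^ (2 * m) * fact m)))"
    by (simp add: gauss_moment_def k add_divide_distrib)
  have "has_bochner_integral lborel (\<lambda>x::real. exp (- (x ^ 2)) * x ^ (2 * m))
     (2 *\<^sub>R (sqrt pi / 2 * (fact (2 * m) / (2 ^ (2 * m) * fact m))))"
    by (rule has_bochner_integral_even_function[OF gaussian_moment_even_pos]) simp
  then show ?thesis
    unfolding G by (simp add: k mult_ac)
next
  case False
  then obtain m where k: "k = 2 * m + 1" by (elim oddE)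
  have "has_bochner_integral lborel (\<lambda>x::real. exp (- (x ^ 2)) * x ^ (2 * m + 1)) 0"
    by (rule has_bochner_integral_odd_function[OF gaussian_moment_odd_pos]) simp
  then show ?thesis
    using False by (simp add: k gauss_moment_def mult_ac)
qed

lemma integrable_poly_gauss:
  "integrable lborel (\<lambda>x. poly p x * exp (- (x ^ 2)) :: real)"
proof -
  have "integrable lborel (\<lambda>x. \<Sum>i\<le>degree p. coeff p i * (x ^ i * exp (- (x ^ 2))))"
    by (intro Bochner_Integration.integrable_sum Bochner_Integration.integrable_mult_right)
       (rule integrable.intros[OF has_bochner_integral_gauss_moment])
  then show ?thesis
    by (simp only: poly_altdef sum_distrib_right mult.assoc)
qed

definition gauss_integral :: "real poly \<Rightarrow> real" where
  "gauss_integral p = (LINT x|lborel. poly p x * exp (- (x ^ 2)))"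

lemma gauss_integral_add: "gauss_integral (p + q) = gauss_integral p + gauss_integral q"
  unfolding gauss_integral_def
  by (subst Bochner_Integration.integral_add[symmetric])
     (auto intro!: integrable_poly_gauss simp: algebra_simps)

lemma gauss_integral_smult: "gauss_integral (smult c p) = c * gauss_integral p"
  unfolding gauss_integral_def
  by (subst integral_mult_right_zero[symmetric]) (simp add: mult_ac)

lemma gauss_integral_0 [simp]: "gauss_integral 0 = 0"
  by (simp add: gauss_integral_def)

lemma gauss_integral_sum: "gauss_integral (\<Sum>i\<in>I. p i) = (\<Sum>i\<in>I. gauss_integral (p i))"
  by (induction I rule: infinite_finite_induct) (simp_all add: gauss_integral_add)

lemma gauss_integral_monom: "gauss_integral (monom c k) = c * gauss_moment k"
proof -
  have "gauss_integral (monom 1 k) = gauss_moment k"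
    using has_bochner_integral_integral_eq[OF has_bochner_integral_gauss_moment[of k]]
    by (simp add: gauss_integral_def poly_monom)
  then show ?thesis
    using gauss_integral_smult[of c "monom 1 k"] by (simp add: smult_monom)
qed

text \<open>
  A polynomial that vanishes almost everywhere is zero, since its roots would otherwise form a finite,
  hence null, set.
\<close>
lemma gauss_integral_square_eq_0:
  assumes "gauss_integral (p * p) \<le> 0"
  shows "p = 0"
proof (rule ccontr)
  assume p: "p \<noteq> 0"
  define f where "f = (\<lambda>x. poly (p * p) x * exp (- (x ^ 2)))"
  have nonneg: "f x \<ge> 0" for x by (simp add: f_def)
  have int: "integrable lborel f"
    unfolding f_def by (rule integrable_poly_gauss)
  have "integral\<^sup>L lborel f \<ge> 0"
    using nonneg by (rule Bochner_Integration.integral_nonneg)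
  with assms have "integral\<^sup>L lborel f = 0"
    unfolding gauss_integral_def f_def by linarith
  then have "AE x in lborel. f x = 0"
    using int nonneg by (subst (asm) integral_nonneg_eq_0_iff_AE) auto
  moreover have "finite {x. f x = 0}"
    using poly_roots_finite[of "p * p"] p by (simp add: f_def)
  then have "AE x in lborel. x \<notin> {x. f x = 0}"
    by (intro AE_not_in finite_imp_null_set_lborel)
  ultimately have "AE x::real in lborel. False" by eventually_elim simp
  then show False
    by (simp add: eventually_False ae_filter_eq_bot_iff)
qed

lemma poly_higher_pderiv_0:
  fixes p :: "real poly"
  shows "poly ((pderiv ^^ i) p) 0 = fact i * coeff p i"
proof -
  have "fact j * coeff ((pderiv ^^ i) p) j = fact (i + j) * coeff p (i + j)" for j
  proof (induction i arbitrary: j)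
    case (Suc i)
    have "fact j * coeff ((pderiv ^^ Suc i) p) j = fact (Suc j) * coeff ((pderiv ^^ i) p) (Suc j)"
      by (simp add: coeff_pderiv algebra_simps)
    then show ?case
      by (simp only: Suc.IH add_Suc_right add_Suc)
  qed simp
  from this[of 0] show ?thesis
    by (simp add: poly_0_coeff_0)
qed

text \<open>
  Derivatives at \<open>0\<close> are coefficients up to a factorial, so the discrete part is diagonal in the
  monomial basis.
\<close>
lemma sobolev_inner_eq:
  "sobolev_inner M P Q =
     gauss_integral (P * Q) + (\<Sum>i\<le>3. M i * (fact i)\<^sup>2 * coeff P i * coeff Q i)"
  by (simp add: sobolev_inner_def gauss_integral_def poly_higher_pderiv_0 power2_eq_square mult_ac)

lemma sobolev_inner_add_left:
  "sobolev_inner M (P + P') Q = sobolev_inner M P Q + sobolev_inner M P' Q"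
  by (simp add: sobolev_inner_eq algebra_simps gauss_integral_add sum.distrib)

lemma sobolev_inner_diff_left:
  "sobolev_inner M (P - P') Q = sobolev_inner M P Q - sobolev_inner M P' Q"
  using sobolev_inner_add_left[of M "P - P'" P' Q] by simp

lemma sobolev_inner_as_sum:
  "sobolev_inner M P Q = (\<Sum>k\<le>degree Q. coeff Q k * sobolev_inner M P (monom 1 k))"
proof -
  have "P * Q = (\<Sum>k\<le>degree Q. smult (coeff Q k) (P * monom 1 k))"
    by (subst (1) poly_as_sum_of_monoms[symmetric])
       (simp add: sum_distrib_left smult_monom flip: mult_smult_right)
  then have 1: "gauss_integral (P * Q) =
      (\<Sum>k\<le>degree Q. coeff Q k * gauss_integral (P * monom 1 k))"
    by (simp add: gauss_integral_sum gauss_integral_smult)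
  have Q: "coeff Q i = (\<Sum>k\<le>degree Q. coeff Q k * coeff (monom 1 k) i)" for i
    by (cases "i \<le> degree Q") (auto simp: if_distrib sum.delta coeff_eq_0 cong: if_cong)
  have "(\<Sum>i\<le>3. M i * (fact i)\<^sup>2 * coeff P i * coeff Q i) =
      (\<Sum>i\<le>3. \<Sum>k\<le>degree Q. coeff Q k * (M i * (fact i)\<^sup>2 * coeff P i * coeff (monom 1 k) i))"
  proof (rule sum.cong[OF refl])
    fix i
    have "M i * (fact i)\<^sup>2 * coeff P i * coeff Q i =
        M i * (fact i)\<^sup>2 * coeff P i * (\<Sum>k\<le>degree Q. coeff Q k * coeff (monom 1 k) i)"
      using Q[of i] by (rule arg_cong)
    then show "M i * (fact i)\<^sup>2 * coeff P i * coeff Q i =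
        (\<Sum>k\<le>degree Q. coeff Q k * (M i * (fact i)\<^sup>2 * coeff P i * coeff (monom 1 k) i))"
      by (simp only: sum_distrib_left mult.left_commute)
  qed
  also have "\<dots> = (\<Sum>k\<le>degree Q. \<Sum>i\<le>3. coeff Q k * (M i * (fact i)\<^sup>2 * coeff P i * coeff (monom 1 k) i))"
    by (rule sum.swap)
  finally show ?thesis
    unfolding sobolev_inner_eq 1 by (simp only: distrib_left sum.distrib sum_distrib_left)
qed

lemma sobolev_inner_orthogonalI:
  assumes "\<And>k. k < n \<Longrightarrow> sobolev_inner M P (monom 1 k) = 0" and "degree Q < n"
  shows "sobolev_inner M P Q = 0"
  using assms by (subst sobolev_inner_as_sum) simp

text \<open>
  The difference of two monic orthogonal polynomials of degree \<open>n\<close> has degree below \<open>n\<close>, so it is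
  orthogonal to both of them and therefore to itself; nonnegative masses force it to be zero.
\<close>
lemma monic_orthogonal_unique:
  assumes M: "\<And>i. i \<le> 3 \<Longrightarrow> M i \<ge> 0"
    and S: "monic_orthogonal_seq (sobolev_inner M) S"
    and T: "degree T = n" "coeff T n = 1"
    and orth: "\<And>k. k < n \<Longrightarrow> sobolev_inner M T (monom 1 k) = 0"
  shows "S n = T"
proof -
  have S': "degree (S n) = n" "coeff (S n) n = 1"
    and orth': "\<And>Q. degree Q < n \<Longrightarrow> sobolev_inner M (S n) Q = 0"
    using S unfolding monic_orthogonal_seq_def by metis+
  have "sobolev_inner M (S n - T) (S n - T) = 0"
  proof (cases "n = 0")
    case True
    with S' T have "S n - T = 0"
      by (metis degree_0_id diff_self)
    then show ?thesis by (simp add: sobolev_inner_eq)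
  next
    case False
    have "coeff (S n - T) k = 0" if "k \<ge> n" for k
      using that S' T by (cases "k = n") (auto simp: coeff_eq_0)
    with False have "degree (S n - T) < n"
      using degree_lessI by blast
    then show ?thesis
      by (simp add: sobolev_inner_diff_left orth' sobolev_inner_orthogonalI[OF orth])
  qed
  moreover have "(\<Sum>i\<le>3. M i * (fact i)\<^sup>2 * coeff p i * coeff p i) \<ge> 0" for p
    by (intro sum_nonneg) (auto simp: M mult.assoc)
  from this[of "S n - T"] have "gauss_integral ((S n - T) * (S n - T)) \<le>
      sobolev_inner M (S n - T) (S n - T)"
    unfolding sobolev_inner_eq by linarith
  ultimately have "gauss_integral ((S n - T) * (S n - T)) \<le> 0"
    by simp
  then show ?thesis
    using gauss_integral_square_eq_0 by force
qed

section \<open>Laguerre polynomials in the squared variable\<close>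

lemma sum_choose_Suc:
  fixes f :: "nat \<Rightarrow> real"
  shows "(\<Sum>j\<le>Suc k. real (Suc k choose j) * f j) =
           (\<Sum>j\<le>k. real (k choose j) * f j) + (\<Sum>j\<le>k. real (k choose j) * f (Suc j))"
proof -
  have "(\<Sum>j\<le>k. real (k choose j) * f j) = (\<Sum>j\<le>Suc k. real (k choose j) * f j)"
    by simp
  also have "\<dots> = f 0 + (\<Sum>j\<le>k. real (k choose Suc j) * f (Suc j))"
    by (subst sum.atMost_Suc_shift) simp
  finally show ?thesis
    by (subst sum.atMost_Suc_shift) (simp add: sum.distrib distrib_right)
qed

lemma Gamma_add_1: "x > 0 \<Longrightarrow> Gamma (x + 1) = x * Gamma (x :: real)"
  by (subst Gamma_plus1) (auto dest: nonpos_Ints_nonpos)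

text \<open>
  The Chu-Vandermonde sum in the form in which it evaluates moments of Laguerre polynomials.
  Pascal's rule replaces the sum for \<open>(k + 1, b, c)\<close> by the difference of those for \<open>(k, b, c)\<close> and
  \<open>(k, b + 1, c + 1)\<close>, which share the Pochhammer factor since it depends on \<open>b - c\<close> only.
\<close>
lemma Gamma_vandermonde:
  fixes b c :: real
  assumes "b > 0" "c > 0"
  shows "(\<Sum>j\<le>k. real (k choose j) * ((-1) ^ j * (Gamma (real j + c) / Gamma (real j + b)))) =
           Gamma c / Gamma (real k + b) * pochhammer (b - c) k"
  using assms
proof (induction k arbitrary: b c)
  case (Suc k)
  define f where "f b c j = (-1) ^ j * (Gamma (real j + c) / Gamma (real j + b))" for b c j
  have shift: "f b c (Suc j) = - f (b + 1) (c + 1) j" for j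
    by (simp add: f_def add_ac)
  have "(\<Sum>j\<le>Suc k. real (Suc k choose j) * f b c j) =
      (\<Sum>j\<le>k. real (k choose j) * f b c j) - (\<Sum>j\<le>k. real (k choose j) * f (b + 1) (c + 1) j)"
    unfolding sum_choose_Suc shift by (simp add: sum_negf)
  also have "\<dots> = Gamma c / Gamma (real k + b) * pochhammer (b - c) k
      - Gamma (c + 1) / Gamma (real k + (b + 1)) * pochhammer (b - c) k"
    using Suc.IH[of b c] Suc.IH[of "b + 1" "c + 1"] Suc.prems by (simp add: f_def)
  also have "\<dots> = Gamma c / Gamma (real k + b + 1) * (pochhammer (b - c) k * (b - c + real k))"
  proof -
    have X: "real k + b > 0"
      using Suc.prems by simp
    have algebra: "G / g * P - c * G / (x * g) * P = G / (x * g) * (P * (x - c))"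
      if "x > 0" for x g G P :: real
      using that by (cases "g = 0") (simp_all add: field_simps)
    have "Gamma (c + 1) = c * Gamma c"
      "Gamma (real k + (b + 1)) = (real k + b) * Gamma (real k + b)"
      "Gamma (real k + b + 1) = (real k + b) * Gamma (real k + b)"
      using Gamma_add_1[OF Suc.prems(2)] Gamma_add_1[OF X] by (simp_all add: add.assoc)
    then show ?thesis
      using algebra[OF X] by (simp only: add_diff_eq diff_add_eq add.commute)
  qed
  finally show ?case
    by (simp add: f_def pochhammer_Suc add_ac)
qed simp

text \<open>
  The coefficient of \<open>t\<^sup>j\<close> in the monic Laguerre polynomial of degree \<open>k\<close> and parameter \<open>r - 1/2\<close>.
\<close>
definition laguerre_coeff :: "nat \<Rightarrow> nat \<Rightarrow> nat \<Rightarrow> real" where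
  "laguerre_coeff k r j =
     (-1) ^ (k + j) * real (k choose j) * Gamma (real (k + r) + 1 / 2) / Gamma (real (j + r) + 1 / 2)"

text \<open>
  The polynomial \<open>x\<^sup>r L(x\<^sup>2)\<close>, with \<open>L\<close> the monic Laguerre polynomial of degree \<open>k\<close> and parameter
  \<open>r - 1/2\<close>. Tying the parameter to the power of \<open>x\<close> covers all polynomials that occur; \<open>r = 0\<close>
  and \<open>r = 1\<close> give the monic Hermite polynomials of even and odd degree.
\<close>
definition laguerre_square :: "nat \<Rightarrow> nat \<Rightarrow> real poly" where
  "laguerre_square k r = (\<Sum>j\<le>k. monom (laguerre_coeff k r j) (2 * j + r))"

lemma coeff_laguerre_square:
  "coeff (laguerre_square k r) i =
     (if r \<le> i \<and> even (i - r) then laguerre_coeff k r ((i - r) div 2) else 0)"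
proof (cases "r \<le> i \<and> even (i - r)")
  case True
  then obtain m where i: "i = 2 * m + r"
    by (metis add.commute dvdE le_add_diff_inverse)
  have "coeff (laguerre_square k r) i = (\<Sum>j\<le>k. if j = m then laguerre_coeff k r j else 0)"
    unfolding laguerre_square_def coeff_sum by (intro sum.cong) (auto simp: i)
  also have "\<dots> = laguerre_coeff k r m"
    by (auto simp: laguerre_coeff_def)
  finally show ?thesis
    by (simp add: i)
next
  case False
  then have "2 * j + r \<noteq> i" for j by auto
  then have "coeff (laguerre_square k r) i = 0"
    by (simp add: laguerre_square_def coeff_sum)
  with False show ?thesis by (simp only: if_False)
qed

lemma gauss_integral_laguerre_square_odd:
  assumes "odd (r + q)"
  shows "gauss_integral (laguerre_square k r * monom 1 q) = 0"
  using assms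
  by (simp add: laguerre_square_def sum_distrib_right mult_monom gauss_integral_sum
      gauss_integral_monom gauss_moment_def)

text \<open>
  The Pochhammer symbol vanishes exactly when \<open>r \<le> m < r + k\<close>. This gives the orthogonality, and
  for \<open>m < r\<close> it gives the nonzero entries of the linear system for the coefficients.
\<close>
lemma gauss_integral_laguerre_square:
  assumes "r + q = 2 * m"
  shows "gauss_integral (laguerre_square k r * monom 1 q) =
           (-1) ^ k * Gamma (real m + 1 / 2) * pochhammer (real r - real m) k"
proof -
  let ?g = "Gamma (real (k + r) + 1 / 2)"
  have "gauss_integral (monom (laguerre_coeff k r j) (2 * j + r) * monom 1 q) =
      (-1) ^ k * ?g * (real (k choose j) *
        ((-1) ^ j * (Gamma (real j + (real m + 1 / 2)) / Gamma (real j + (real r + 1 / 2)))))" for j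
  proof -
    have "2 * j + r + q = 2 * (j + m)"
      using assms by simp
    then have "gauss_integral (monom (laguerre_coeff k r j) (2 * j + r) * monom 1 q) =
        laguerre_coeff k r j * gauss_moment (2 * (j + m))"
      by (simp only: mult_monom gauss_integral_monom mult_1_right)
    then show ?thesis
      by (simp add: gauss_moment_def laguerre_coeff_def power_add add_divide_distrib add_ac)
  qed
  then have "gauss_integral (laguerre_square k r * monom 1 q) =
      (-1) ^ k * ?g * (\<Sum>j\<le>k. real (k choose j) *
        ((-1) ^ j * (Gamma (real j + (real m + 1 / 2)) / Gamma (real j + (real r + 1 / 2)))))"
    by (simp add: laguerre_square_def sum_distrib_right gauss_integral_sum sum_distrib_left)
  also have "\<dots> = (-1) ^ k * Gamma (real m + 1 / 2) * pochhammer (real r - real m) k"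
  proof -
    have arg: "real k + (real r + 1 / 2) = real (k + r) + 1 / 2" by simp
    have "?g \<noteq> 0"
      by (rule less_imp_neq[symmetric], intro Gamma_real_pos) simp
    then show ?thesis
      by (subst Gamma_vandermonde) (simp_all only: arg, auto)
  qed
  finally show ?thesis .
qed

lemma sobolev_inner_monom:
  "sobolev_inner M P (monom 1 q) =
     gauss_integral (P * monom 1 q) + (if q \<le> 3 then M q * (fact q)\<^sup>2 * coeff P q else 0)"
proof -
  have "(\<Sum>i\<le>3. M i * (fact i)\<^sup>2 * coeff P i * coeff (monom 1 q) i) =
      (\<Sum>i\<le>3. if i = q then M i * (fact i)\<^sup>2 * coeff P i else 0)"
    by (intro sum.cong) auto
  also have "\<dots> = (if q \<le> 3 then M q * (fact q)\<^sup>2 * coeff P q else 0)"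
    by simp
  finally show ?thesis
    unfolding sobolev_inner_eq by simp
qed

section \<open>Orthogonality of the three-term combination\<close>

definition hermite_combination :: "nat \<Rightarrow> nat \<Rightarrow> real \<Rightarrow> real \<Rightarrow> real \<Rightarrow> real poly" where
  "hermite_combination e n A B C =
     smult A (laguerre_square n e) + smult B (laguerre_square (n - 1) (e + 2))
       + smult C (laguerre_square (n - 2) (e + 4))"

lemma hermite_combination_monic:
  assumes "n \<ge> 2" "A + B + C = 1"
  shows "degree (hermite_combination e n A B C) = 2 * n + e"
    and "coeff (hermite_combination e n A B C) (2 * n + e) = 1"
proof -
  have lead: "coeff (laguerre_square (n - i) (e + 2 * i)) (2 * n + e) = 1" if "i \<le> n" for i
  proof -
    have "2 * n + e - (e + 2 * i) = 2 * (n - i)" by simp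
    moreover have "Gamma (real (n - i + (e + 2 * i)) + 1 / 2) \<noteq> 0"
      by (rule less_imp_neq[symmetric], intro Gamma_real_pos) simp
    ultimately show ?thesis
      by (simp add: coeff_laguerre_square laguerre_coeff_def that del: of_nat_add)
  qed
  show 1: "coeff (hermite_combination e n A B C) (2 * n + e) = 1"
    using assms lead[of 0] lead[of 1] lead[of 2] by (simp add: hermite_combination_def)
  have zero: "coeff (laguerre_square (n - i) (e + 2 * i)) l = 0" if "l > 2 * n + e" "i \<le> n" for i l
  proof (cases "e + 2 * i \<le> l \<and> even (l - (e + 2 * i))")
    case True
    then obtain m where m: "l - (e + 2 * i) = 2 * m" by blast
    with True that have "n - i < (l - (e + 2 * i)) div 2"
      by simp
    then show ?thesis
      by (simp add: coeff_laguerre_square laguerre_coeff_def)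
  qed (auto simp: coeff_laguerre_square)
  have "coeff (hermite_combination e n A B C) l = 0" if "l > 2 * n + e" for l
    using assms that zero[of l 0] zero[of l 1] zero[of l 2] by (simp add: hermite_combination_def)
  then have "degree (hermite_combination e n A B C) \<le> 2 * n + e"
    by (intro degree_le) auto
  moreover have "degree (hermite_combination e n A B C) \<ge> 2 * n + e"
    using 1 by (intro le_degree) simp
  ultimately show "degree (hermite_combination e n A B C) = 2 * n + e" by simp
qed

text \<open>
  The hypotheses on \<open>A\<close>, \<open>B\<close>, \<open>C\<close> are the conditions against \<open>x\<^sup>e\<close> and \<open>x\<^sup>e\<^sup>+\<^sup>2\<close> with the sign
  \<open>(-1)\<^sup>n\<close> removed. The bound \<open>e \<le> 1\<close> ensures that \<open>e\<close> and \<open>e + 2\<close> are the only indices of their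
  parity that carry a mass.
\<close>
lemma hermite_combination_orthogonal:
  assumes n: "n \<ge> 2" and e: "e \<le> 1" and q: "q < 2 * n + e"
  defines "g \<equiv> Gamma (real n + real e + 1 / 2)"
  assumes eq0: "B * Gamma (real e + 3 / 2) * fact (n - 1) =
      C * Gamma (real e + 5 / 2) * fact (n - 1) + M e * (fact e)\<^sup>2 * A * g / Gamma (real e + 1 / 2)"
    and eq1: "C * Gamma (real e + 7 / 2) * fact (n - 2) =
      M (e + 2) * (fact (e + 2))\<^sup>2 *
        (A * real n * g / Gamma (real e + 3 / 2)
          + B * (real n + real e + 1 / 2) * g / Gamma (real e + 5 / 2))"
  shows "sobolev_inner M (hermite_combination e n A B C) (monom 1 q) = 0"
proof -
  let ?T = "hermite_combination e n A B C"
  have gauss: "gauss_integral (?T * monom 1 q) =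
      A * gauss_integral (laguerre_square n e * monom 1 q)
      + B * gauss_integral (laguerre_square (n - 1) (e + 2) * monom 1 q)
      + C * gauss_integral (laguerre_square (n - 2) (e + 4) * monom 1 q)"
    by (simp add: hermite_combination_def algebra_simps gauss_integral_add gauss_integral_smult)
  show ?thesis
  proof (cases "even (q + e)")
    case False
    then have "gauss_integral (?T * monom 1 q) = 0"
      unfolding gauss by (subst (1 2 3) gauss_integral_laguerre_square_odd) auto
    moreover have "coeff ?T q = 0"
      using False by (auto simp: hermite_combination_def coeff_laguerre_square)
    ultimately show ?thesis
      by (simp add: sobolev_inner_monom)
  next
    case True
    have "q \<ge> e"
      using True e by (cases "q = 0") (auto simp: le_Suc_eq)
    then obtain s where s: "q = 2 * s + e"
      using True by (metis add.commute dvdE even_add even_diff_nat le_add_diff_inverse)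
    have sn: "s < n"
      using q s by simp
    have int: "gauss_integral (laguerre_square (n - i) (e + 2 * i) * monom 1 q) =
        (-1) ^ (n - i) * Gamma (real (e + i + s) + 1 / 2) * pochhammer (real i - real s) (n - i)" for i
      by (subst gauss_integral_laguerre_square[of _ _ "e + i + s"]) (auto simp: s)
    \<comment> \<open>Here \<open>i - s\<close> is a nonpositive integer above \<open>i - n\<close>, so one factor is zero.\<close>
    have vanish: "pochhammer (real i - real s) (n - i) = 0" if "i \<le> s" for i
      using that sn pochhammer_of_nat_eq_0_lemma[of "s - i" "n - i", where 'a = real]
      by (simp add: of_nat_diff)
    have sign: "(-1) ^ (n - Suc 0) = - ((-1) ^ n :: real)" "(-1) ^ (n - 2) = ((-1) ^ n :: real)"
      using n by (auto simp: le_iff_add)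
    consider "s = 0" | "s = 1" | "s \<ge> 2" by linarith
    then show ?thesis
    proof cases
      case 1
      have "pochhammer 2 (n - 2) = (fact (n - 1) :: real)"
      proof -
        have "Suc (n - 2) = n - 1" using n by simp
        then show ?thesis
          using pochhammer_rec[of "1 :: real" "n - 2"] by (simp add: pochhammer_fact)
      qed
      moreover have "pochhammer 1 (n - 1) = (fact (n - 1) :: real)"
        by (simp add: pochhammer_fact)
      ultimately have "gauss_integral (?T * monom 1 q) =
          (-1) ^ n * (C * Gamma (real e + 5 / 2) * fact (n - 1) - B * Gamma (real e + 3 / 2) * fact (n - 1))"
        unfolding gauss using int[of 0] int[of 1] int[of 2] vanish[of 0] 1
        by (simp add: sign algebra_simps)
      moreover have "coeff ?T q = A * (-1) ^ n * g / Gamma (real e + 1 / 2)"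
        by (simp add: hermite_combination_def coeff_laguerre_square s 1 laguerre_coeff_def g_def)
      moreover have "q \<le> 3" "q = e"
        using s 1 e by auto
      ultimately have "sobolev_inner M ?T (monom 1 q) = (-1) ^ n *
          (C * Gamma (real e + 5 / 2) * fact (n - 1) + M e * (fact e)\<^sup>2 * A * g / Gamma (real e + 1 / 2)
            - B * Gamma (real e + 3 / 2) * fact (n - 1))"
        unfolding sobolev_inner_monom by (simp only: if_True) (simp add: algebra_simps)
      then show ?thesis
        using eq0 by simp
    next
      case 2
      have "pochhammer 1 (n - 2) = (fact (n - 2) :: real)"
        by (simp add: pochhammer_fact)
      then have "gauss_integral (?T * monom 1 q) =
          (-1) ^ n * (C * Gamma (real e + 7 / 2) * fact (n - 2))"
        unfolding gauss using int[of 0] int[of 1] int[of 2] vanish[of 0] vanish[of 1] 2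
        by (simp add: sign algebra_simps)
      moreover have "coeff ?T q = - ((-1) ^ n * (A * real n * g / Gamma (real e + 3 / 2)
          + B * (real n + real e + 1 / 2) * g / Gamma (real e + 5 / 2)))"
      proof -
        have "coeff ?T q = A * laguerre_coeff n e 1 + B * laguerre_coeff (n - 1) (e + 2) 0"
          by (simp add: hermite_combination_def coeff_laguerre_square s 2)
        moreover have "laguerre_coeff n e 1 = - ((-1) ^ n * (real n * g / Gamma (real e + 3 / 2)))"
        proof -
          have "real (1 + e) + 1 / 2 = real e + 3 / 2" by simp
          then show ?thesis
            unfolding laguerre_coeff_def by (simp only:) (simp add: g_def)
        qed
        moreover have "laguerre_coeff (n - 1) (e + 2) 0 =
            - ((-1) ^ n * ((real n + real e + 1 / 2) * g / Gamma (real e + 5 / 2)))"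
        proof -
          have "real (n - 1 + (e + 2)) + 1 / 2 = real n + real e + 1 / 2 + 1"
            using n by (simp add: of_nat_diff)
          then have "Gamma (real (n - 1 + (e + 2)) + 1 / 2) = (real n + real e + 1 / 2) * g"
            unfolding g_def by (simp only:) (rule Gamma_add_1, simp)
          moreover have "real (0 + (e + 2)) + 1 / 2 = real e + 5 / 2" by simp
          ultimately show ?thesis
            unfolding laguerre_coeff_def by (simp only:) (simp add: sign)
        qed
        ultimately show ?thesis
          by (simp only:) (simp add: algebra_simps)
      qed
      moreover have "q \<le> 3" "q = e + 2"
        using s 2 e by auto
      ultimately have "sobolev_inner M ?T (monom 1 q) = (-1) ^ n *
          (C * Gamma (real e + 7 / 2) * fact (n - 2) - M (e + 2) * (fact (e + 2))\<^sup>2 *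
            (A * real n * g / Gamma (real e + 3 / 2)
              + B * (real n + real e + 1 / 2) * g / Gamma (real e + 5 / 2)))"
        unfolding sobolev_inner_monom by (simp only: if_True) (simp add: right_diff_distrib mult_ac)
      then show ?thesis
        using eq1 by simp
    next
      case 3
      have "gauss_integral (?T * monom 1 q) = 0"
        unfolding gauss using int[of 0] int[of 1] int[of 2] vanish[of 0] vanish[of 1] vanish[of 2] 3
        by simp
      then show ?thesis
        using 3 by (simp add: sobolev_inner_monom s)
    qed
  qed
qed

section \<open>Mehler-Heine asymptotics\<close>

lemma tendsto_add_const_over_n: "(\<lambda>n. (real n + c) / real n) \<longlonglongrightarrow> 1"
proof -
  have "(\<lambda>n. 1 + c / real n) \<longlonglongrightarrow> 1 + 0"
    by (intro tendsto_intros lim_const_over_n)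
  moreover have "\<forall>\<^sub>F n in sequentially. 1 + c / real n = (real n + c) / real n"
    using eventually_gt_at_top[of 0] by eventually_elim (simp add: add_divide_distrib)
  ultimately show ?thesis
    by (simp add: Lim_transform_eventually)
qed

text \<open>
  Euler's limit for the Gamma function at \<open>z = k + 1/2\<close>. It involves \<open>\<Gamma>(z + n + 1)\<close>, so one factor
  \<open>(n + z)/n \<rightarrow> 1\<close> has to be removed.
\<close>
lemma Gamma_ratio_limit:
  "(\<lambda>n. Gamma (real n + real k + 1 / 2) * sqrt (real n) / (fact n * real n ^ k)) \<longlonglongrightarrow> 1"
proof -
  define z where "z = real k + 1 / 2"
  have z: "z > 0" by (simp add: z_def)
  have G: "Gamma z \<noteq> 0"
    using Gamma_real_pos[OF z] by (rule less_imp_neq[symmetric])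
  have ev: "eventually (\<lambda>n. (real n / (real n + z)) * (Gamma z * rGamma_series z n) =
      Gamma (real n + real k + 1 / 2) * sqrt (real n) / (fact n * real n ^ k)) sequentially"
    using eventually_gt_at_top[of 0]
  proof eventually_elim
    fix n :: nat
    assume n: "n > 0"
    have nz: "real n + z > 0"
      using z by simp
    have "pochhammer z (n + 1) = Gamma (z + real (n + 1)) / Gamma z"
      using z by (intro pochhammer_Gamma) (auto dest: nonpos_Ints_nonpos)
    moreover have "Gamma (z + real (n + 1)) = (real n + z) * Gamma (real n + z)"
      using Gamma_add_1[OF nz] by (simp add: add_ac)
    moreover have "exp (z * ln (real n)) = real n ^ k * sqrt (real n)"
    proof -
      have "exp (z * ln (real n)) = real n powr (real k + 1 / 2)"
        using n by (simp add: powr_def z_def)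
      then show ?thesis
        using n by (simp only: powr_add) (simp add: powr_realpow powr_half_sqrt)
    qed
    ultimately have "(real n / (real n + z)) * (Gamma z * rGamma_series z n) =
        real n * Gamma (real n + z) / (fact n * (real n ^ k * sqrt (real n)))"
      using nz G by (simp add: rGamma_series_def)
    also have "\<dots> = Gamma (real n + z) * sqrt (real n) / (fact n * real n ^ k)"
      using n by (simp add: field_simps)
    finally show "(real n / (real n + z)) * (Gamma z * rGamma_series z n) =
      Gamma (real n + real k + 1 / 2) * sqrt (real n) / (fact n * real n ^ k)"
      by (simp add: z_def add_ac)
  qed
  have "(\<lambda>n. real n / (real n + z)) \<longlonglongrightarrow> 1"
    using tendsto_inverse[OF tendsto_add_const_over_n[of z]] by simp
  then have "(\<lambda>n. (real n / (real n + z)) * (Gamma z * rGamma_series z n)) \<longlonglongrightarrow> 1 * (Gamma z * rGamma z)"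
    by (intro tendsto_intros)
  also have "1 * (Gamma z * rGamma z) = 1"
    using G by (simp add: rGamma_inverse_Gamma)
  finally show ?thesis
    using ev by (rule Lim_transform_eventually)
qed

text \<open>
  A uniform version of Tannery's theorem. For weights that do not depend on \<open>x\<close>, the error is
  bounded on all of \<open>K\<close> by the single numerical series \<open>\<Sum>j. \<bar>w n j - 1\<bar> * H j\<close>, to which the
  pointwise theorem applies.
\<close>
lemma uniform_limit_weighted_series:
  fixes w :: "nat \<Rightarrow> nat \<Rightarrow> real" and h :: "nat \<Rightarrow> 'a \<Rightarrow> complex"
  assumes lim: "\<And>j. (\<lambda>n. w n j) \<longlonglongrightarrow> 1"
    and bound: "\<And>n j. \<bar>w n j\<bar> \<le> W"
    and H: "\<And>j x. x \<in> K \<Longrightarrow> norm (h j x) \<le> H j" "summable H" "\<And>j. H j \<ge> 0"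
  shows "uniform_limit K (\<lambda>n x. \<Sum>j. of_real (w n j) * h j x) (\<lambda>x. \<Sum>j. h j x) sequentially"
proof -
  define E where "E = (\<lambda>n. \<Sum>j. \<bar>w n j - 1\<bar> * H j)"
  have dom: "\<bar>w n j - 1\<bar> * H j \<le> (W + 1) * H j" for n j
    using bound[of n j] H(3) by (intro mult_right_mono) auto
  have E_summable: "summable (\<lambda>j. \<bar>w n j - 1\<bar> * H j)" for n
    by (rule summable_comparison_test'[where g = "\<lambda>j. (W + 1) * H j" and N = 0])
       (use dom H(2,3) in \<open>auto simp: abs_mult intro: summable_mult\<close>)
  have "(\<lambda>n. \<Sum>j. \<bar>w n j - 1\<bar> * H j) \<longlonglongrightarrow> (\<Sum>j. 0 :: real)"
  proof (rule tannerys_theorem[THEN conjunct2, THEN conjunct2])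
    show "((\<lambda>n. \<bar>w n j - 1\<bar> * H j) \<longlongrightarrow> 0) sequentially" for j
      using tendsto_mult[OF tendsto_rabs[OF tendsto_diff[OF lim[of j] tendsto_const[of 1]]]
          tendsto_const[of "H j"]] by simp
    show "\<forall>\<^sub>F (j, n) in sequentially \<times>\<^sub>F sequentially.
        norm (\<bar>w n j - 1\<bar> * H j) \<le> (W + 1) * H j"
      using dom H(3) by (intro always_eventually) (auto simp: abs_mult)
    show "summable (\<lambda>j. (W + 1) * H j)"
      using H(2) by (rule summable_mult)
  qed simp
  then have E0: "E \<longlonglongrightarrow> 0"
    by (simp add: E_def)
  have diff: "norm ((\<Sum>j. of_real (w n j) * h j x) - (\<Sum>j. h j x)) \<le> E n" if x: "x \<in> K" for n x
  proof -
    have hs: "summable (\<lambda>j. h j x)"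
      by (rule summable_comparison_test'[OF H(2), of 0]) (use H(1) x in auto)
    have ds: "summable (\<lambda>j. norm (of_real (w n j - 1) * h j x))"
      by (rule summable_comparison_test'[OF E_summable[of n], of 0])
         (use H(1) x in \<open>auto simp: norm_mult intro!: mult_left_mono simp flip: of_real_diff\<close>)
    have "(\<Sum>j. of_real (w n j) * h j x) = (\<Sum>j. of_real (w n j - 1) * h j x + h j x)"
      by (simp add: algebra_simps)
    also have "\<dots> = (\<Sum>j. of_real (w n j - 1) * h j x) + (\<Sum>j. h j x)"
      using ds hs by (intro suminf_add[symmetric] summable_norm_cancel[OF ds])
    finally have "norm ((\<Sum>j. of_real (w n j) * h j x) - (\<Sum>j. h j x)) =
        norm (\<Sum>j. of_real (w n j - 1) * h j x)" by simp
    also have "\<dots> \<le> (\<Sum>j. norm (of_real (w n j - 1) * h j x))"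
      using ds by (rule summable_norm)
    also have "\<dots> \<le> E n"
      unfolding E_def using ds E_summable[of n]
      by (intro suminf_le)
         (use H(1) x in \<open>auto simp: norm_mult intro!: mult_left_mono simp flip: of_real_diff\<close>)
    finally show ?thesis .
  qed
  show ?thesis
  proof (rule uniform_limitI)
    fix \<epsilon> :: real
    assume "\<epsilon> > 0"
    with E0 have "\<forall>\<^sub>F n in sequentially. E n < \<epsilon>"
      by (rule order_tendstoD)
    then show "\<forall>\<^sub>F n in sequentially. \<forall>x\<in>K.
        dist (\<Sum>j. of_real (w n j) * h j x) (\<Sum>j. h j x) < \<epsilon>"
      by eventually_elim (use diff in \<open>fastforce simp: dist_norm intro: le_less_trans\<close>)
  qed
qed

lemma falling_factorial_ratio_le_1:
  assumes "m \<le> n"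
  shows "real (m choose j) * fact j / real n ^ j \<le> 1"
proof (cases "j \<le> m")
  case True
  have "real (m choose j) * fact j = (\<Prod>l=0..<j. real m - real l)"
    by (simp add: binomial_gbinomial gbinomial_prod_rev)
  also have "\<dots> \<le> (\<Prod>l=0..<j. real n)"
    using True assms by (intro prod_mono) auto
  finally show ?thesis
    by (auto simp: divide_le_eq_1)
qed (simp add: not_le binomial_eq_0)

lemma falling_factorial_ratio_limit:
  "(\<lambda>n. real ((n - i) choose j) * fact j / real n ^ j) \<longlonglongrightarrow> 1"
proof -
  have "(\<lambda>n. \<Prod>l=0..<j. (real n - real i - real l) / real n) \<longlonglongrightarrow> (\<Prod>l=0..<j. 1)"
  proof (intro tendsto_prod)
    have "real n + (- real i - real l) = real n - real i - real l" for n l by simp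
    then show "(\<lambda>n. (real n - real i - real l) / real n) \<longlonglongrightarrow> 1" for l
      using tendsto_add_const_over_n[of "- real i - real l"] by (simp only:)
  qed
  moreover have "eventually (\<lambda>n. (\<Prod>l=0..<j. (real n - real i - real l) / real n) =
      real ((n - i) choose j) * fact j / real n ^ j) sequentially"
    using eventually_ge_at_top[of i]
    by eventually_elim (simp add: binomial_gbinomial gbinomial_prod_rev prod_dividef of_nat_diff)
  ultimately show ?thesis
    by (simp add: Lim_transform_eventually)
qed

text \<open>
  The terms of the series of \<open>(x/2)\<^sup>1\<^sup>/\<^sup>2 J\<^sub>\<alpha>(x)\<close> for \<open>\<alpha> = r - 1/2\<close>.
\<close>
definition bessel_term :: "nat \<Rightarrow> nat \<Rightarrow> complex \<Rightarrow> complex" where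
  "bessel_term r j x =
     (-1) ^ j / (fact j * of_real (Gamma (real j + real r + 1 / 2))) * (x / 2) ^ (2 * j + r)"

lemma sqrt_bessel_J_half: "sqrt_bessel_J (real r - 1 / 2) x = (\<Sum>j. bessel_term r j x)"
  by (simp add: sqrt_bessel_J_def bessel_term_def algebra_simps)

definition bessel_majorant :: "nat \<Rightarrow> real \<Rightarrow> nat \<Rightarrow> real" where
  "bessel_majorant r R j = R ^ (2 * j + r) / (fact j * Gamma (real j + real r + 1 / 2))"

lemma norm_bessel_term_le:
  assumes "norm x \<le> 2 * R"
  shows "norm (bessel_term r j x) \<le> bessel_majorant r R j"
proof -
  have G: "Gamma (real j + real r + 1 / 2) > 0" by (intro Gamma_real_pos) simp
  have "norm (bessel_term r j x) =
      (norm x / 2) ^ (2 * j + r) / (fact j * Gamma (real j + real r + 1 / 2))"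
    using G by (simp add: bessel_term_def norm_mult norm_divide norm_power)
  also have "\<dots> \<le> bessel_majorant r R j"
    unfolding bessel_majorant_def using assms G
    by (intro divide_right_mono power_mono) auto
  finally show ?thesis .
qed

text \<open>
  On the imaginary axis the signs of the Bessel series cancel: at \<open>x = 2iR\<close> its terms are the
  majorant times the constant \<open>i\<^sup>r\<close>. Convergence of the series there is thus absolute convergence.
\<close>
lemma summable_bessel_majorant: "summable (bessel_majorant r R)"
proof -
  have "summable (\<lambda>m. (-1) ^ m / (fact m * complex_of_real (Gamma (real m + (real r - 1 / 2) + 1)))
                         * ((2 * \<i> * of_real R) / 2) ^ (2 * m + r))"
    by (rule summable_sqrt_bessel_J) simp
  also have "(\<lambda>m. (-1) ^ m / (fact m * complex_of_real (Gamma (real m + (real r - 1 / 2) + 1)))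
                         * ((2 * \<i> * of_real R) / 2) ^ (2 * m + r)) =
      (\<lambda>m. \<i> ^ r * complex_of_real (bessel_majorant r R m))"
  proof
    fix m
    have arg: "real m + (real r - 1 / 2) + 1 = real m + real r + 1 / 2" by simp
    have "\<i> ^ (2 * m + r) = (-1) ^ m * \<i> ^ r"
      by (simp add: power_add power_mult)
    then have "((2 * \<i> * of_real R) / 2) ^ (2 * m + r) = (-1) ^ m * \<i> ^ r * of_real R ^ (2 * m + r)"
      by (simp add: power_mult_distrib)
    then show "(-1) ^ m / (fact m * complex_of_real (Gamma (real m + (real r - 1 / 2) + 1)))
                         * ((2 * \<i> * of_real R) / 2) ^ (2 * m + r) =
        \<i> ^ r * complex_of_real (bessel_majorant r R m)"
      unfolding arg bessel_majorant_def by simp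
  qed
  finally have "summable (\<lambda>m. complex_of_real (bessel_majorant r R m))"
    by (simp add: summable_cmult_iff)
  then show ?thesis
    by (simp add: summable_complex_of_real)
qed

lemma cpoly_sum_monom: "cpoly (\<Sum>j\<in>I. monom (c j) (p j)) x = (\<Sum>j\<in>I. of_real (c j) * x ^ p j)"
proof -
  have "map_poly complex_of_real (\<Sum>j\<in>I. monom (c j) (p j)) = (\<Sum>j\<in>I. monom (of_real (c j)) (p j))"
    by (rule poly_eqI) (simp add: coeff_map_poly coeff_sum if_distrib cong: if_cong)
  then show ?thesis
    by (simp add: poly_sum poly_monom)
qed

text \<open>
  Up to the sign \<open>(-1)\<^sup>i\<close>, the coefficients of the rescaled polynomial are those of the Bessel series
  times bounded weights that tend to \<open>1\<close>. Such a weight is the Gamma ratio times the falling factorial ratio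
  \<open>(n - i)(n - i - 1)\<dots>(n - i - j + 1) / n\<^sup>j\<close>. The factor \<open>\<surd>n\<close> in even degree only compensates for
  the missing \<open>x / \<surd>n\<close>, so the exponent \<open>1 - e\<close> treats both parities together.
\<close>
lemma mehler_heine:
  assumes e: "e \<le> 1" and K: "bounded K"
  shows "uniform_limit K
    (\<lambda>n x. (-1) ^ n * of_real (sqrt (real n)) ^ (1 - e) / fact n
        * cpoly (laguerre_square (n - i) (e + 2 * i)) (x / (2 * of_real (sqrt (real n)))))
    (\<lambda>x. (-1) ^ i * sqrt_bessel_J (real (e + 2 * i) - 1 / 2) x) sequentially"
proof -
  define r where "r = e + 2 * i"
  define \<rho> where "\<rho> = (\<lambda>n. Gamma (real n + real (e + i) + 1 / 2) * sqrt (real n)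
                          / (fact n * real n ^ (e + i)))"
  define w where "w = (\<lambda>n j. \<rho> n * (real ((n - i) choose j) * fact j / real n ^ j))"
  obtain R where R: "\<And>x. x \<in> K \<Longrightarrow> norm x \<le> 2 * R"
  proof -
    obtain b where "\<And>x. x \<in> K \<Longrightarrow> norm x \<le> b"
      using K by (auto simp: bounded_iff)
    then show thesis by (intro that[of "b / 2"]) auto
  qed
  have \<rho>: "\<rho> \<longlonglongrightarrow> 1"
    unfolding \<rho>_def by (rule Gamma_ratio_limit)
  obtain W where W: "\<And>n. \<bar>\<rho> n\<bar> \<le> W"
    using convergent_imp_Bseq[OF convergentI[OF \<rho>]] by (auto simp: Bseq_def)
  have w: "(\<lambda>n. w n j) \<longlonglongrightarrow> 1" for j
    using tendsto_mult[OF \<rho> falling_factorial_ratio_limit[of i j]] by (simp add: w_def)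
  have w_le: "\<bar>w n j\<bar> \<le> W" for n j
  proof -
    have "\<bar>w n j\<bar> \<le> \<bar>\<rho> n\<bar> * 1"
      unfolding w_def abs_mult using falling_factorial_ratio_le_1[of "n - i" n j]
      by (intro mult_left_mono) auto
    then show ?thesis using W[of n] by simp
  qed
  have maj: "norm (bessel_term r j x) \<le> bessel_majorant r \<bar>R\<bar> j" if "x \<in> K" for j x
    using R[OF that] by (intro norm_bessel_term_le) auto
  have nonneg: "bessel_majorant r \<bar>R\<bar> j \<ge> 0" for j
    unfolding bessel_majorant_def by (intro divide_nonneg_nonneg mult_nonneg_nonneg) auto
  have lim: "uniform_limit K (\<lambda>n x. \<Sum>j. of_real (w n j) * bessel_term r j x)
      (\<lambda>x. \<Sum>j. bessel_term r j x) sequentially"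
    using w w_le maj summable_bessel_majorant nonneg by (rule uniform_limit_weighted_series)
  have eq: "(-1) ^ i * (\<Sum>j. of_real (w n j) * bessel_term r j x) =
      (-1) ^ n * of_real (sqrt (real n)) ^ (1 - e) / fact n
        * cpoly (laguerre_square (n - i) r) (x / (2 * of_real (sqrt (real n))))"
    if n: "n \<ge> i" "n > 0" for n x
  proof -
    define t where "t = complex_of_real (sqrt (real n))"
    have t: "t \<noteq> 0" using n by (simp add: t_def)
    have t2: "t ^ 2 = of_nat n" "t * t = of_nat n"
      by (simp_all add: t_def flip: of_real_power of_real_mult)
    \<comment> \<open>The powers of \<open>\<surd>n\<close> combine to those in the two ratios, since \<open>r = e + 2 * i\<close>.\<close>
    have scale: "t ^ (1 - e) / t ^ (2 * j + r) = t / of_nat n ^ (e + i + j)" for j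
    proof -
      have "t ^ (1 - e) * of_nat n ^ (e + i + j) = t ^ (1 - e + 2 * (e + i + j))"
        by (simp only: t2(1)[symmetric] power_add power_mult)
      also have "1 - e + 2 * (e + i + j) = Suc (2 * j + r)"
        using e by (simp add: r_def)
      finally show ?thesis
        using t n by (simp add: field_simps)
    qed
    have sign: "(-1) ^ n * (-1) ^ (n - i + j) = (-1) ^ i * (-1 :: complex) ^ j" for j
    proof -
      have "(-1) ^ n * (-1) ^ (n - i) = (-1 :: complex) ^ i"
      proof -
        obtain m where "n = i + m"
          using n le_Suc_ex by blast
        then show ?thesis by (simp add: power_add mult.assoc)
      qed
      then show ?thesis by (simp add: power_add flip: mult.assoc)
    qed
    have "of_real (w n j) * ((-1) ^ i * bessel_term r j x) =
        (-1) ^ n * t ^ (1 - e) / fact n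
          * (of_real (laguerre_coeff (n - i) r j) * (x / (2 * t)) ^ (2 * j + r))" for j
    proof -
      have G: "Gamma (real (n - i + r) + 1 / 2) = Gamma (real n + real (e + i) + 1 / 2)"
        using n by (simp add: r_def of_nat_diff algebra_simps)
      have "(-1) ^ n * t ^ (1 - e) / fact n
          * (of_real (laguerre_coeff (n - i) r j) * (x / (2 * t)) ^ (2 * j + r)) =
          ((-1) ^ n * (-1) ^ (n - i + j)) * (t ^ (1 - e) / t ^ (2 * j + r)) / fact n *
           of_nat ((n - i) choose j) * of_real (Gamma (real n + real (e + i) + 1 / 2))
             / of_real (Gamma (real (j + r) + 1 / 2)) * (x / 2) ^ (2 * j + r)"
        unfolding laguerre_coeff_def G by (simp add: power_divide power_mult_distrib mult_ac)
      also have "\<dots> = of_real (w n j) * ((-1) ^ i * bessel_term r j x)"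
        unfolding sign scale
        by (simp add: w_def \<rho>_def bessel_term_def t_def power_add mult_ac)
      finally show ?thesis ..
    qed
    note terms = this
    have "(-1) ^ i * (\<Sum>j. of_real (w n j) * bessel_term r j x) =
        (-1) ^ i * (\<Sum>j\<le>n - i. of_real (w n j) * bessel_term r j x)"
      by (subst suminf_finite[of "{..n - i}"]) (auto simp: w_def)
    also have "\<dots> = (\<Sum>j\<le>n - i. of_real (w n j) * ((-1) ^ i * bessel_term r j x))"
      by (simp add: sum_distrib_left mult_ac)
    also have "\<dots> = (-1) ^ n * t ^ (1 - e) / fact n * cpoly (laguerre_square (n - i) r) (x / (2 * t))"
      unfolding terms laguerre_square_def cpoly_sum_monom by (simp add: sum_distrib_left)
    finally show ?thesis by (simp add: t_def)
  qed
  have "uniform_limit K (\<lambda>n x. (-1) ^ i * (\<Sum>j. of_real (w n j) * bessel_term r j x))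
      (\<lambda>x. (-1) ^ i * (\<Sum>j. bessel_term r j x)) sequentially"
    using lim by (rule bounded_linear_uniform_limit_intros)
  then show ?thesis
  proof (rule uniform_limit_cong[THEN iffD1, rotated 2])
    show "\<forall>\<^sub>F n in sequentially. \<forall>x\<in>K. (-1) ^ i * (\<Sum>j. of_real (w n j) * bessel_term r j x) =
      (-1) ^ n * of_real (sqrt (real n)) ^ (1 - e) / fact n
        * cpoly (laguerre_square (n - i) (e + 2 * i)) (x / (2 * of_real (sqrt (real n))))"
      using eventually_ge_at_top[of i] eventually_gt_at_top[of 0]
      unfolding r_def[symmetric] by eventually_elim (intro ballI eq)
    show "(-1) ^ i * (\<Sum>j. bessel_term r j x) =
        (-1) ^ i * sqrt_bessel_J (real (e + 2 * i) - 1 / 2) x" for x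
      unfolding r_def sqrt_bessel_J_half ..
  qed
qed

lemma bounded_sqrt_bessel_J:
  assumes "bounded K"
  shows "bounded (sqrt_bessel_J (real r - 1 / 2) ` K)"
proof -
  obtain b where b: "\<And>x. x \<in> K \<Longrightarrow> norm x \<le> b"
    using assms by (auto simp: bounded_iff)
  have "norm (sqrt_bessel_J (real r - 1 / 2) x) \<le> (\<Sum>j. bessel_majorant r (b / 2) j)" if "x \<in> K" for x
    unfolding sqrt_bessel_J_half
    using b[OF that] by (intro norm_suminf_le norm_bessel_term_le summable_bessel_majorant) auto
  then show ?thesis
    by (auto simp: bounded_iff)
qed

section \<open>The coefficients of the combination and their limits\<close>

text \<open>
  The masses as they appear in the linear system once it is brought to the form
  \<open>B = \<kappa> C + a A\<close>, \<open>C = b (A + B s / \<kappa>)\<close>, \<open>A + B + C = 1\<close> with \<open>\<kappa> = e + 3/2\<close> and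
  \<open>s = (n + e + 1/2) / n\<close>: the value mass is \<open>a\<close> and the slope mass is \<open>b\<close>. They weigh the value
  and the derivative at \<open>0\<close> of the polynomial in \<open>t = x\<^sup>2\<close>.
\<close>
definition value_mass :: "(nat \<Rightarrow> real) \<Rightarrow> nat \<Rightarrow> nat \<Rightarrow> real" where
  "value_mass M e n = M e * (fact e)\<^sup>2 * Gamma (real n + real e + 1 / 2)
     / (Gamma (real e + 1 / 2) * Gamma (real e + 3 / 2) * fact (n - 1))"

definition slope_mass :: "(nat \<Rightarrow> real) \<Rightarrow> nat \<Rightarrow> nat \<Rightarrow> real" where
  "slope_mass M e n = M (e + 2) * (fact (e + 2))\<^sup>2 * (real n * Gamma (real n + real e + 1 / 2))
     / (Gamma (real e + 3 / 2) * Gamma (real e + 7 / 2) * fact (n - 2))"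

text \<open>
  The determinant of that system; the three quotients below are its solution by Cramer's rule.
\<close>
definition mix_denom :: "real \<Rightarrow> real \<Rightarrow> real \<Rightarrow> real \<Rightarrow> real" where
  "mix_denom \<kappa> a b s = 1 + a + b * (\<kappa> + 1 - s) + a * b * s / \<kappa>"

definition mix_A :: "real \<Rightarrow> real \<Rightarrow> real \<Rightarrow> real \<Rightarrow> real" where
  "mix_A \<kappa> a b s = (1 - b * s) / mix_denom \<kappa> a b s"

definition mix_B :: "real \<Rightarrow> real \<Rightarrow> real \<Rightarrow> real \<Rightarrow> real" where
  "mix_B \<kappa> a b s = (a + b * \<kappa>) / mix_denom \<kappa> a b s"

definition mix_C :: "real \<Rightarrow> real \<Rightarrow> real \<Rightarrow> real \<Rightarrow> real" where
  "mix_C \<kappa> a b s = b * (1 + a * s / \<kappa>) / mix_denom \<kappa> a b s"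

text \<open>
  Solvability for every choice of nonnegative masses rests on \<open>s \<le> \<kappa> + 1\<close>, which makes all terms
  of the determinant nonnegative.
\<close>
lemma mix_denom_pos:
  assumes "\<kappa> > 0" "a \<ge> 0" "b \<ge> 0" "0 \<le> s" "s \<le> \<kappa> + 1"
  shows "mix_denom \<kappa> a b s > 0"
proof -
  have "a * b * s / \<kappa> \<ge> 0" "b * (\<kappa> + 1 - s) \<ge> 0"
    using assms by simp_all
  with assms show ?thesis
    unfolding mix_denom_def by linarith
qed

lemma mix_solves:
  assumes "\<kappa> > 0" and D: "mix_denom \<kappa> a b s > 0"
  shows "mix_A \<kappa> a b s + mix_B \<kappa> a b s + mix_C \<kappa> a b s = 1"
    and "mix_B \<kappa> a b s = \<kappa> * mix_C \<kappa> a b s + a * mix_A \<kappa> a b s"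
    and "mix_C \<kappa> a b s = b * (mix_A \<kappa> a b s + mix_B \<kappa> a b s * s / \<kappa>)"
proof -
  have l: "\<kappa> \<noteq> 0" "mix_denom \<kappa> a b s \<noteq> 0" using assms by auto
  have "(1 - b * s) + (a + b * \<kappa>) + b * (1 + a * s / \<kappa>) = mix_denom \<kappa> a b s"
    by (simp add: mix_denom_def algebra_simps)
  then show "mix_A \<kappa> a b s + mix_B \<kappa> a b s + mix_C \<kappa> a b s = 1"
    using l by (simp add: mix_A_def mix_B_def mix_C_def flip: add_divide_distrib)
  have "a + b * \<kappa> = \<kappa> * (b * (1 + a * s / \<kappa>)) + a * (1 - b * s)"
    using l(1) by (simp add: field_simps)
  then show "mix_B \<kappa> a b s = \<kappa> * mix_C \<kappa> a b s + a * mix_A \<kappa> a b s"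
    by (simp add: mix_A_def mix_B_def mix_C_def add_divide_distrib)
  have "b * (1 + a * s / \<kappa>) = b * ((1 - b * s) + (a + b * \<kappa>) * s / \<kappa>)"
    using l(1) by (simp add: field_simps)
  moreover have "b * (X + Y * s / \<kappa>) / D = b * (X / D + Y / D * s / \<kappa>)" for X Y D
    by (simp add: add_divide_distrib distrib_left)
  ultimately show "mix_C \<kappa> a b s = b * (mix_A \<kappa> a b s + mix_B \<kappa> a b s * s / \<kappa>)"
    by (simp only: mix_A_def mix_B_def mix_C_def)
qed

lemma sobolev_hermite_eq:
  assumes M: "\<And>i. i \<le> 3 \<Longrightarrow> M i \<ge> 0"
    and S: "monic_orthogonal_seq (sobolev_inner M) S"
    and n: "n \<ge> 2" and e: "e \<le> 1"
  defines "\<kappa> \<equiv> real e + 3 / 2" and "s \<equiv> (real n + real e + 1 / 2) / real n"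
    and "a \<equiv> value_mass M e n" and "b \<equiv> slope_mass M e n"
  shows "S (2 * n + e) =
    hermite_combination e n (mix_A \<kappa> a b s) (mix_B \<kappa> a b s) (mix_C \<kappa> a b s)"
proof -
  let ?A = "mix_A \<kappa> a b s" and ?B = "mix_B \<kappa> a b s" and ?C = "mix_C \<kappa> a b s"
  let ?g = "Gamma (real n + real e + 1 / 2)"
  have G: "Gamma (real e + 1 / 2) > 0" "Gamma (real e + 3 / 2) > 0" "Gamma (real e + 5 / 2) > 0"
    "Gamma (real e + 7 / 2) > 0" "?g > 0"
    by (auto intro!: Gamma_real_pos)
  then have G_nz: "Gamma (real e + 1 / 2) \<noteq> 0" "Gamma (real e + 3 / 2) \<noteq> 0"
    "Gamma (real e + 5 / 2) \<noteq> 0" "Gamma (real e + 7 / 2) \<noteq> 0"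
    by (metis less_irrefl)+
  have \<kappa>: "\<kappa> > 0" by (simp add: \<kappa>_def)
  have G52: "Gamma (real e + 5 / 2) = \<kappa> * Gamma (real e + 3 / 2)"
    using Gamma_add_1[OF \<kappa>] by (simp add: \<kappa>_def add.commute)
  have "a \<ge> 0"
    unfolding a_def value_mass_def using M[of e] e G
    by (intro divide_nonneg_nonneg mult_nonneg_nonneg) auto
  moreover have "b \<ge> 0"
    unfolding b_def slope_mass_def using M[of "e + 2"] e G
    by (intro divide_nonneg_nonneg mult_nonneg_nonneg) auto
  moreover have "0 \<le> s" "s \<le> \<kappa> + 1"
  proof -
    have "s = 1 + (real e + 1 / 2) / real n"
      using n by (simp add: s_def field_simps)
    moreover have "(real e + 1 / 2) / real n \<le> (real e + 1 / 2) / 1"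
      using n by (intro divide_left_mono) auto
    ultimately show "0 \<le> s" "s \<le> \<kappa> + 1"
      by (simp_all add: \<kappa>_def)
  qed
  ultimately have D: "mix_denom \<kappa> a b s > 0"
    using \<kappa> by (intro mix_denom_pos)
  note sol = mix_solves[OF \<kappa> D]
  have orth: "sobolev_inner M (hermite_combination e n ?A ?B ?C) (monom 1 q) = 0"
    if q: "q < 2 * n + e" for q
  proof (rule hermite_combination_orthogonal[OF n e q])
    have "a * Gamma (real e + 3 / 2) * fact (n - 1) =
        M e * (fact e)\<^sup>2 * ?g / Gamma (real e + 1 / 2)"
      using G_nz by (simp add: a_def value_mass_def)
    moreover have "?B * Gamma (real e + 3 / 2) * fact (n - 1) =
        ?C * Gamma (real e + 5 / 2) * fact (n - 1) + ?A * (a * Gamma (real e + 3 / 2) * fact (n - 1))"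
      unfolding G52 by (subst sol(2)) (simp add: algebra_simps)
    ultimately show "?B * Gamma (real e + 3 / 2) * fact (n - 1) =
        ?C * Gamma (real e + 5 / 2) * fact (n - 1)
          + M e * (fact e)\<^sup>2 * ?A * ?g / Gamma (real e + 1 / 2)"
      by simp
    have "?C * Gamma (real e + 7 / 2) * fact (n - 2) =
        (?A + ?B * s / \<kappa>) * (b * Gamma (real e + 7 / 2) * fact (n - 2))"
      by (subst sol(3)) simp
    also have "b * Gamma (real e + 7 / 2) * fact (n - 2) =
        M (e + 2) * (fact (e + 2))\<^sup>2 * (real n * ?g / Gamma (real e + 3 / 2))"
      using G_nz by (simp add: b_def slope_mass_def)
    also have "(?A + ?B * s / \<kappa>) *
          (M (e + 2) * (fact (e + 2))\<^sup>2 * (real n * ?g / Gamma (real e + 3 / 2))) =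
        M (e + 2) * (fact (e + 2))\<^sup>2 *
          ((?A + ?B * s / \<kappa>) * (real n * ?g / Gamma (real e + 3 / 2)))"
      by (rule mult.left_commute)
    also have "(?A + ?B * s / \<kappa>) * (real n * ?g / Gamma (real e + 3 / 2)) =
        ?A * real n * ?g / Gamma (real e + 3 / 2)
          + ?B * (real n + real e + 1 / 2) * ?g / Gamma (real e + 5 / 2)"
    proof -
      have sn: "real n + real e + 1 / 2 = s * real n"
        using n by (simp add: s_def)
      show ?thesis
        unfolding G52 sn by (simp add: distrib_right distrib_left add_divide_distrib mult_ac)
    qed
    finally show "?C * Gamma (real e + 7 / 2) * fact (n - 2) =
        M (e + 2) * (fact (e + 2))\<^sup>2 * (?A * real n * ?g / Gamma (real e + 3 / 2)
          + ?B * (real n + real e + 1 / 2) * ?g / Gamma (real e + 5 / 2))" .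
  qed
  show ?thesis
    using M S hermite_combination_monic[OF n sol(1), of e] orth
    by (rule monic_orthogonal_unique[of M S])
qed

lemma Gamma_over_fact_at_top:
  "filterlim (\<lambda>n. Gamma (real n + real e + 1 / 2) / fact (n - 1)) at_top sequentially"
proof -
  have "filterlim (\<lambda>n. Gamma (real n + real e + 1 / 2) * sqrt (real n) / (fact n * real n ^ e)
      * (real n ^ e * sqrt (real n))) at_top sequentially"
  proof (rule filterlim_tendsto_pos_mult_at_top[OF Gamma_ratio_limit])
    have "filterlim (\<lambda>n. sqrt (real n)) at_top sequentially"
      by (rule filterlim_compose[OF sqrt_at_top filterlim_real_sequentially])
    moreover have "\<forall>\<^sub>F n in sequentially. sqrt (real n) \<le> real n ^ e * sqrt (real n)"
      using eventually_ge_at_top[of 1]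
    proof eventually_elim
      fix n :: nat
      assume "n \<ge> 1"
      then have "real n ^ e \<ge> 1" by (intro one_le_power) simp
      then show "sqrt (real n) \<le> real n ^ e * sqrt (real n)"
        using mult_right_mono[of 1 "real n ^ e" "sqrt (real n)"] by simp
    qed
    ultimately show "filterlim (\<lambda>n. real n ^ e * sqrt (real n)) at_top sequentially"
      by (rule filterlim_at_top_mono)
  qed simp
  moreover have "\<forall>\<^sub>F n in sequentially.
      Gamma (real n + real e + 1 / 2) * sqrt (real n) / (fact n * real n ^ e) * (real n ^ e * sqrt (real n))
        = Gamma (real n + real e + 1 / 2) / fact (n - 1)"
    using eventually_gt_at_top[of 0]
    by eventually_elim (simp add: fact_reduce)
  ultimately show ?thesis
    by (rule filterlim_cong[THEN iffD1, OF refl refl, rotated])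
qed

lemma value_mass_at_top:
  assumes "M e > 0"
  shows "filterlim (value_mass M e) at_top sequentially"
proof -
  define c where "c = M e * (fact e)\<^sup>2 / (Gamma (real e + 1 / 2) * Gamma (real e + 3 / 2))"
  have "Gamma (real e + 1 / 2) > 0" "Gamma (real e + 3 / 2) > 0"
    by (auto intro!: Gamma_real_pos)
  then have "c > 0"
    using assms unfolding c_def by (intro divide_pos_pos mult_pos_pos) auto
  then have "filterlim (\<lambda>n. c * (Gamma (real n + real e + 1 / 2) / fact (n - 1))) at_top sequentially"
    by (rule filterlim_tendsto_pos_mult_at_top[OF tendsto_const _ Gamma_over_fact_at_top])
  then show ?thesis
    by (simp add: c_def value_mass_def[abs_def])
qed

text \<open>
  Growth is inherited from the value mass: \<open>n / (n - 2)!\<close> is at least \<open>1 / (n - 1)!\<close>.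
\<close>
lemma slope_mass_at_top:
  assumes "M (e + 2) > 0"
  shows "filterlim (slope_mass M e) at_top sequentially"
proof -
  define c where "c = M (e + 2) * (fact (e + 2))\<^sup>2 / (Gamma (real e + 3 / 2) * Gamma (real e + 7 / 2))"
  have "Gamma (real e + 3 / 2) > 0" "Gamma (real e + 7 / 2) > 0"
    by (auto intro!: Gamma_real_pos)
  then have c: "c > 0"
    using assms unfolding c_def by (intro divide_pos_pos mult_pos_pos) auto
  then have "filterlim (\<lambda>n. c * (Gamma (real n + real e + 1 / 2) / fact (n - 1))) at_top sequentially"
    by (rule filterlim_tendsto_pos_mult_at_top[OF tendsto_const _ Gamma_over_fact_at_top])
  moreover have "\<forall>\<^sub>F n in sequentially.
      c * (Gamma (real n + real e + 1 / 2) / fact (n - 1)) \<le> slope_mass M e n"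
    using eventually_ge_at_top[of 1]
  proof eventually_elim
    fix n :: nat
    assume n: "n \<ge> 1"
    have G: "Gamma (real n + real e + 1 / 2) \<ge> 0"
      by (intro Gamma_real_nonneg) simp
    have "Gamma (real n + real e + 1 / 2) / fact (n - 1) \<le>
        Gamma (real n + real e + 1 / 2) / fact (n - 2)"
      using G by (intro divide_left_mono fact_mono mult_pos_pos) auto
    also have "\<dots> \<le> real n * (Gamma (real n + real e + 1 / 2) / fact (n - 2))"
      using n G mult_right_mono[of 1 "real n" "Gamma (real n + real e + 1 / 2) / fact (n - 2)"]
      by simp
    finally have "c * (Gamma (real n + real e + 1 / 2) / fact (n - 1)) \<le>
        c * (real n * (Gamma (real n + real e + 1 / 2) / fact (n - 2)))"
      using c by (intro mult_left_mono) auto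
    also have "\<dots> = slope_mass M e n"
      by (simp only: c_def slope_mass_def times_divide_eq_left times_divide_eq_right divide_divide_eq_left)
    finally show "c * (Gamma (real n + real e + 1 / 2) / fact (n - 1)) \<le> slope_mass M e n" .
  qed
  ultimately show ?thesis
    by (rule filterlim_at_top_mono)
qed

text \<open>
  Numerator and denominator are divided by those of \<open>a\<close>, \<open>b\<close> that tend to infinity. With
  \<open>u = 1/a\<close> or \<open>u = 1\<close> as the case may be, and \<open>x = u a \<in> {0, 1}\<close>, always \<open>u \<rightarrow> 1 - x\<close>; likewise
  for \<open>v\<close>, \<open>y\<close> and \<open>b\<close>. All four cases become one computation whose limiting denominator is nonzero.
\<close>
lemma mix_limits:
  assumes l: "\<kappa> > 0" and s: "s \<longlonglongrightarrow> 1"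
    and a: "if p then filterlim a at_top sequentially else a = (\<lambda>n. 0)"
    and b: "if q then filterlim b at_top sequentially else b = (\<lambda>n. 0)"
  shows "(\<lambda>n. mix_A \<kappa> (a n) (b n) (s n)) \<longlonglongrightarrow> (if p then 0 else if q then - 1 / \<kappa> else 1)"
    and "(\<lambda>n. mix_B \<kappa> (a n) (b n) (s n)) \<longlonglongrightarrow> (if p = q then 0 else 1)"
    and "(\<lambda>n. mix_C \<kappa> (a n) (b n) (s n)) \<longlonglongrightarrow> (if q then if p then 1 else 1 / \<kappa> else 0)"
proof -
  define u v where "u n = (if p then inverse (a n) else 1)"
    and "v n = (if q then inverse (b n) else 1)" for n
  define x y :: real where "x = (if p then 1 else 0)" and "y = (if q then 1 else 0)"
  have u: "u \<longlonglongrightarrow> 1 - x"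
    using a by (auto simp: u_def[abs_def] x_def intro: tendsto_inverse_0_at_top)
  have v: "v \<longlonglongrightarrow> 1 - y"
    using b by (auto simp: v_def[abs_def] y_def intro: tendsto_inverse_0_at_top)
  have "\<forall>\<^sub>F n in sequentially. p \<longrightarrow> a n > 0"
    using a by (cases p) (auto simp: filterlim_at_top_dense)
  then have ua: "\<forall>\<^sub>F n in sequentially. u n \<noteq> 0 \<and> u n * a n = x"
    by eventually_elim (use a in \<open>auto simp: u_def x_def\<close>)
  have "\<forall>\<^sub>F n in sequentially. q \<longrightarrow> b n > 0"
    using b by (cases q) (auto simp: filterlim_at_top_dense)
  then have vb: "\<forall>\<^sub>F n in sequentially. v n \<noteq> 0 \<and> v n * b n = y"
    by eventually_elim (use b in \<open>auto simp: v_def y_def\<close>)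
  \<comment> \<open>The denominator of the solution, multiplied by \<open>u n * v n\<close>.\<close>
  define D where
    "D n = u n * v n + x * v n + y * u n * (\<kappa> + 1 - s n) + x * y * s n / \<kappa>" for n
  define d where "d = (1 - x) * (1 - y) + x * (1 - y) + y * (1 - x) * \<kappa> + x * y / \<kappa>"
  have D: "D \<longlonglongrightarrow> d"
    unfolding D_def[abs_def] d_def
    by (rule tendsto_eq_intros u v s refl | use l in simp)+
  have d: "d \<noteq> 0"
    using l by (auto simp: d_def x_def y_def)
  have scaled: "\<forall>\<^sub>F n in sequentially.
      (u n * v n - u n * y * s n) / D n = mix_A \<kappa> (a n) (b n) (s n)
      \<and> (x * v n + u n * y * \<kappa>) / D n = mix_B \<kappa> (a n) (b n) (s n)
      \<and> y * (u n + x * s n / \<kappa>) / D n = mix_C \<kappa> (a n) (b n) (s n)"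
    using ua vb
  proof eventually_elim
    case (elim n)
    let ?w = "u n * v n"
    have w: "?w \<noteq> 0" using elim by simp
    have xy: "x = u n * a n" "y = v n * b n" using elim by simp_all
    have "D n = ?w * mix_denom \<kappa> (a n) (b n) (s n)"
      unfolding D_def mix_denom_def xy by (simp add: algebra_simps)
    moreover have "u n * v n - u n * y * s n = ?w * (1 - b n * s n)"
      "x * v n + u n * y * \<kappa> = ?w * (a n + b n * \<kappa>)"
      "y * (u n + x * s n / \<kappa>) = ?w * (b n * (1 + a n * s n / \<kappa>))"
      unfolding xy by (simp_all add: algebra_simps)
    ultimately show ?case
      using w by (simp only: mix_A_def mix_B_def mix_C_def mult_divide_mult_cancel_left) simp
  qed
  have "(\<lambda>n. (u n * v n - u n * y * s n) / D n) \<longlonglongrightarrow> ((1 - x) * (1 - y) - (1 - x) * y * 1) / d"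
    by (intro tendsto_intros u v s D d)
  then have "(\<lambda>n. mix_A \<kappa> (a n) (b n) (s n)) \<longlonglongrightarrow> ((1 - x) * (1 - y) - (1 - x) * y * 1) / d"
    by (rule Lim_transform_eventually) (use scaled in eventually_elim, simp)
  then show "(\<lambda>n. mix_A \<kappa> (a n) (b n) (s n)) \<longlonglongrightarrow> (if p then 0 else if q then - 1 / \<kappa> else 1)"
    by (simp add: x_def y_def d_def split: if_splits)
  have "(\<lambda>n. (x * v n + u n * y * \<kappa>) / D n) \<longlonglongrightarrow> (x * (1 - y) + (1 - x) * y * \<kappa>) / d"
    by (intro tendsto_intros u v s D d)
  then have "(\<lambda>n. mix_B \<kappa> (a n) (b n) (s n)) \<longlonglongrightarrow> (x * (1 - y) + (1 - x) * y * \<kappa>) / d"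
    by (rule Lim_transform_eventually) (use scaled in eventually_elim, simp)
  then show "(\<lambda>n. mix_B \<kappa> (a n) (b n) (s n)) \<longlonglongrightarrow> (if p = q then 0 else 1)"
    using l by (simp add: x_def y_def d_def split: if_splits)
  have "(\<lambda>n. y * (u n + x * s n / \<kappa>) / D n) \<longlonglongrightarrow> y * ((1 - x) + x * 1 / \<kappa>) / d"
    using l by (intro tendsto_intros u v s D d) auto
  then have "(\<lambda>n. mix_C \<kappa> (a n) (b n) (s n)) \<longlonglongrightarrow> y * ((1 - x) + x * 1 / \<kappa>) / d"
    by (rule Lim_transform_eventually) (use scaled in eventually_elim, simp)
  then show "(\<lambda>n. mix_C \<kappa> (a n) (b n) (s n)) \<longlonglongrightarrow> (if q then if p then 1 else 1 / \<kappa> else 0)"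
    using l by (simp add: x_def y_def d_def split: if_splits)
qed

section \<open>The limits of the Sobolev-type polynomials\<close>

lemma cpoly_hermite_combination:
  "cpoly (hermite_combination e n A B C) x =
     of_real A * cpoly (laguerre_square n e) x
     + of_real B * cpoly (laguerre_square (n - 1) (e + 2)) x
     + of_real C * cpoly (laguerre_square (n - 2) (e + 4)) x"
proof -
  have "map_poly complex_of_real (P + Q) = map_poly of_real P + map_poly of_real Q" for P Q
    by (rule poly_eqI) (simp add: coeff_map_poly)
  then have add: "cpoly (P + Q) x = cpoly P x + cpoly Q x" for P Q
    by simp
  have "map_poly complex_of_real (smult c P) = smult (of_real c) (map_poly of_real P)" for c P
    by (rule poly_eqI) (simp add: coeff_map_poly)
  then have smult: "cpoly (smult c P) x = of_real c * cpoly P x" for c P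
    by simp
  show ?thesis
    by (simp only: hermite_combination_def add smult)
qed

lemma uniform_limit_const_in_x:
  assumes "f \<longlonglongrightarrow> (l :: 'b :: metric_space)"
  shows "uniform_limit K (\<lambda>n x. f n) (\<lambda>x. l) sequentially"
  using assms by (auto intro!: uniform_limitI elim!: eventually_mono dest!: tendstoD)

lemma sobolev_hermite_limit:
  fixes M :: "nat \<Rightarrow> real" and K :: "complex set"
  assumes M: "\<And>i. i \<le> 3 \<Longrightarrow> M i \<ge> 0"
    and S: "monic_orthogonal_seq (sobolev_inner M) S"
    and K: "bounded K" and e: "e \<le> 1"
  defines "\<kappa> \<equiv> real e + 3 / 2"
  defines "A \<equiv> (if M e > 0 then 0 else if M (e + 2) > 0 then - 1 / \<kappa> else 1)"
    and "B \<equiv> (if (M e > 0) = (M (e + 2) > 0) then 0 else 1)"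
    and "C \<equiv> (if M (e + 2) > 0 then if M e > 0 then 1 else 1 / \<kappa> else 0)"
  shows "uniform_limit K
    (\<lambda>n x. (-1) ^ n * of_real (sqrt (real n)) ^ (1 - e) / fact n
        * cpoly (S (2 * n + e)) (x / (2 * of_real (sqrt (real n)))))
    (\<lambda>x. of_real A * sqrt_bessel_J (real e - 1 / 2) x
        - of_real B * sqrt_bessel_J (real e + 3 / 2) x
        + of_real C * sqrt_bessel_J (real e + 7 / 2) x) sequentially"
proof -
  define s where "s n = (real n + real e + 1 / 2) / real n" for n
  define a b where "a = value_mass M e" and "b = slope_mass M e"
  define An Bn Cn where "An n = mix_A \<kappa> (a n) (b n) (s n)"
    and "Bn n = mix_B \<kappa> (a n) (b n) (s n)" and "Cn n = mix_C \<kappa> (a n) (b n) (s n)" for n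
  have l: "\<kappa> > 0" by (simp add: \<kappa>_def)
  have s: "s \<longlonglongrightarrow> 1"
    using tendsto_add_const_over_n[of "real e + 1 / 2"] by (simp add: s_def[abs_def] add.assoc)
  have "M e \<ge> 0" "M (e + 2) \<ge> 0" using M e by auto
  then have "if M e > 0 then filterlim a at_top sequentially else a = (\<lambda>n. 0)"
    and "if M (e + 2) > 0 then filterlim b at_top sequentially else b = (\<lambda>n. 0)"
    by (auto simp: a_def b_def value_mass_at_top slope_mass_at_top value_mass_def slope_mass_def
        not_less fun_eq_iff)
  note lims = mix_limits[OF l s this, folded An_def Bn_def Cn_def A_def B_def C_def]
  define F where "F i n x = (-1) ^ n * of_real (sqrt (real n)) ^ (1 - e) / fact n
      * cpoly (laguerre_square (n - i) (e + 2 * i)) (x / (2 * of_real (sqrt (real n))))"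
    for i n and x :: complex
  define L where "L i x = (-1) ^ i * sqrt_bessel_J (real (e + 2 * i) - 1 / 2) x" for i x
  have F: "uniform_limit K (F i) (L i) sequentially" for i
    unfolding F_def[abs_def] L_def[abs_def] using e K by (rule mehler_heine)
  have bL: "bounded (L i ` K)" for i
  proof -
    have "bounded ((\<lambda>z. (-1) ^ i * z) ` sqrt_bessel_J (real (e + 2 * i) - 1 / 2) ` K)"
      by (intro bounded_linear_image bounded_sqrt_bessel_J K bounded_linear_mult_right)
    then show ?thesis
      by (simp add: image_image L_def[abs_def])
  qed
  have scaled: "uniform_limit K (\<lambda>n x. of_real (c n) * F i n x) (\<lambda>x. of_real c' * L i x) sequentially"
    if "c \<longlonglongrightarrow> c'" for c c' i
    using that bL F
    by (intro uniform_lim_mult uniform_limit_const_in_x tendsto_of_real) (auto simp: image_constant_conv)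
  have "uniform_limit K
      (\<lambda>n x. of_real (An n) * F 0 n x + of_real (Bn n) * F 1 n x + of_real (Cn n) * F 2 n x)
      (\<lambda>x. of_real A * L 0 x + of_real B * L 1 x + of_real C * L 2 x) sequentially"
    by (intro uniform_limit_add scaled lims)
  then show ?thesis
  proof (rule uniform_limit_cong[THEN iffD1, rotated 2])
    show "\<forall>\<^sub>F n in sequentially. \<forall>x\<in>K.
        of_real (An n) * F 0 n x + of_real (Bn n) * F 1 n x + of_real (Cn n) * F 2 n x =
        (-1) ^ n * of_real (sqrt (real n)) ^ (1 - e) / fact n
          * cpoly (S (2 * n + e)) (x / (2 * of_real (sqrt (real n))))"
      using eventually_ge_at_top[of 2]
    proof eventually_elim
      fix n :: nat
      assume "n \<ge> 2"
      then have "S (2 * n + e) = hermite_combination e n (An n) (Bn n) (Cn n)"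
        unfolding An_def Bn_def Cn_def a_def b_def s_def \<kappa>_def
        using M S \<open>n \<ge> 2\<close> e by (intro sobolev_hermite_eq[of M S]) auto
      then show "\<forall>x\<in>K. of_real (An n) * F 0 n x + of_real (Bn n) * F 1 n x + of_real (Cn n) * F 2 n x =
        (-1) ^ n * of_real (sqrt (real n)) ^ (1 - e) / fact n
          * cpoly (S (2 * n + e)) (x / (2 * of_real (sqrt (real n))))"
        by (simp add: cpoly_hermite_combination F_def distrib_left mult_ac)
    qed
    show "of_real A * L 0 x + of_real B * L 1 x + of_real C * L 2 x =
        of_real A * sqrt_bessel_J (real e - 1 / 2) x
        - of_real B * sqrt_bessel_J (real e + 3 / 2) x
        + of_real C * sqrt_bessel_J (real e + 7 / 2) x" for x
    proof -
      have "real (e + 2 * 1) - 1 / 2 = real e + 3 / 2" "real (e + 2 * 2) - 1 / 2 = real e + 7 / 2"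
        by simp_all
      then show ?thesis
        unfolding L_def by (simp only:) simp
    qed
  qed
qed

theorem theorem2:
  fixes M :: "nat \<Rightarrow> real" and S :: "nat \<Rightarrow> real poly" and K :: "complex set"
  assumes M: "\<And>i. i \<le> 3 \<Longrightarrow> M i \<ge> 0"
    and S: "monic_orthogonal_seq (sobolev_inner M) S"
    and K: "compact K"
  shows
    "uniform_limit K
       (\<lambda>n x. (-1) ^ n * of_real (sqrt (real n)) / fact n
              * cpoly (S (2 * n)) (x / (2 * of_real (sqrt (real n)))))
       (\<lambda>x. if M 0 = 0 \<and> M 2 = 0 then sqrt_bessel_J (-1/2) x
             else if M 0 > 0 \<and> M 2 = 0 then - sqrt_bessel_J (3/2) x
             else if M 0 = 0 \<and> M 2 > 0 then
               2/3 * sqrt_bessel_J (7/2) x - sqrt_bessel_J (3/2) x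
                 - 2/3 * sqrt_bessel_J (-1/2) x
             else sqrt_bessel_J (7/2) x)
       sequentially
     \<and> uniform_limit K
       (\<lambda>n x. (-1) ^ n / fact n
              * cpoly (S (2 * n + 1)) (x / (2 * of_real (sqrt (real n)))))
       (\<lambda>x. if M 1 = 0 \<and> M 3 = 0 then sqrt_bessel_J (1/2) x
             else if M 1 > 0 \<and> M 3 = 0 then - sqrt_bessel_J (5/2) x
             else if M 1 = 0 \<and> M 3 > 0 then
               2/5 * sqrt_bessel_J (9/2) x - sqrt_bessel_J (5/2) x
                 - 2/5 * sqrt_bessel_J (1/2) x
             else sqrt_bessel_J (9/2) x)
       sequentially"
proof (rule conjI)
  have K': "bounded K" using K by (rule compact_imp_bounded)
  have M0: "M 0 \<ge> 0" "M 1 \<ge> 0" "M 2 \<ge> 0" "M 3 \<ge> 0" by (simp_all add: M)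
  show "uniform_limit K
       (\<lambda>n x. (-1) ^ n * of_real (sqrt (real n)) / fact n
              * cpoly (S (2 * n)) (x / (2 * of_real (sqrt (real n)))))
       (\<lambda>x. if M 0 = 0 \<and> M 2 = 0 then sqrt_bessel_J (-1/2) x
             else if M 0 > 0 \<and> M 2 = 0 then - sqrt_bessel_J (3/2) x
             else if M 0 = 0 \<and> M 2 > 0 then
               2/3 * sqrt_bessel_J (7/2) x - sqrt_bessel_J (3/2) x
                 - 2/3 * sqrt_bessel_J (-1/2) x
             else sqrt_bessel_J (7/2) x)
       sequentially" (is "uniform_limit K ?f ?l sequentially")
  proof -
    have num: "2 * n + 0 = 2 * (n :: nat)" "0 + 2 = (2 :: nat)" "real 0 - 1 / 2 = - 1 / 2"
      "real 0 + 3 / 2 = 3 / 2" "real 0 + 7 / 2 = 7 / 2" for n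
      by simp_all
    note lim = sobolev_hermite_limit[OF M S K' zero_le_one, unfolded num]
    show ?thesis
      by (rule uniform_limit_cong[THEN iffD1, rotated 2, OF lim]) (use M0 in \<open>auto simp: less_le\<close>)
  qed
  show "uniform_limit K
       (\<lambda>n x. (-1) ^ n / fact n
              * cpoly (S (2 * n + 1)) (x / (2 * of_real (sqrt (real n)))))
       (\<lambda>x. if M 1 = 0 \<and> M 3 = 0 then sqrt_bessel_J (1/2) x
             else if M 1 > 0 \<and> M 3 = 0 then - sqrt_bessel_J (5/2) x
             else if M 1 = 0 \<and> M 3 > 0 then
               2/5 * sqrt_bessel_J (9/2) x - sqrt_bessel_J (5/2) x
                 - 2/5 * sqrt_bessel_J (1/2) x
             else sqrt_bessel_J (9/2) x)
       sequentially" (is "uniform_limit K ?f ?l sequentially")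
  proof -
    have num: "1 + 2 = (3 :: nat)" "real 1 - 1 / 2 = 1 / 2"
      "real 1 + 3 / 2 = 5 / 2" "real 1 + 7 / 2 = 9 / 2"
      by simp_all
    note lim = sobolev_hermite_limit[OF M S K' le_refl, unfolded num]
    show ?thesis
      by (rule uniform_limit_cong[THEN iffD1, rotated 2, OF lim]) (use M0 in \<open>auto simp: less_le\<close>)
  qed
qed

end
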